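(* Let $X$ be a compact metric space, let $\mathcal{L}$ be a transfer operator on $C^0(X,\mathbb{C})$, and let $\mu\in\mathcal{M}$ be such that $\mathcal{L}^*\mu=\mu$. Let $\varphi:X\to\mathbb{R}$ be bounded and measurable. For each natural number $n\ge1$ and each real number $\alpha$, denote $$\varphi_n:=\sum_{j=0}^{n-1}\mathcal{L}^j\varphi,\qquad C_\alpha:=\Big\{x\in X:\ \sup_{n\ge1}\frac{\varphi_n(x)}{n}>\alpha\Big\}.$$ Then, for any real number $\alpha$ and any measurable set $A\subset C_\alpha$ such that $(\mathcal{L}\chi_A)(x)=\chi_A(x)$ for $\mu$-a.e. $x\in X$, the following inequality holds: $$\int_A\varphi\,d\mu\ \ge\ \alpha\cdot\mu(A).$$
   Context: $X$ is a compact metric space, $\mathcal{A}$ its Borel sigma-algebra (measurable means with respect to $\mathcal{A}$), $\mathcal{M}$ the set of all probability measures on $(X,\mathcal{A})$, and $C^0(X,\mathbb{C})$ the space of continuous functions $X\to\mathbb{C}$ with the supremum norm. $\chi_A$ denotes the characteristic function of $A$. A transfer operator is a linear operator $\mathcal{L}:C^0(X,\mathbb{C})\to C^0(X,\mathbb{C})$ such that: (1) $\mathcal{L}\varphi$ is real and non-negative whenever $\varphi$ is real and non-negative; (2) $\max_{x\in X}|(\mathcal{L}\varphi)(x)|\le\max_{x\in X}|\varphi(x)|$ for all $\varphi\in C^0(X,\mathbb{C})$, and $\mathcal{L}1=1$. Its dual transfer operator $\mathcal{L}^*:\mathcal{M}\to\mathcal{M}$ is the unique map with $\int\varphi\,d(\mathcal{L}^*\mu)=\int\mathcal{L}\varphi\,d\mu$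 for all $\varphi\in C^0(X,\mathbb{C})$ and $\mu\in\mathcal{M}$. For each $x\in X$, $P(x,\cdot)\in\mathcal{M}$ denotes the unique probability measure with $(\mathcal{L}\varphi)(x)=\int\varphi(y)\,P(x,dy)$ for all $\varphi\in C^0(X,\mathbb{C})$. $L_\infty$ denotes the set of bounded functions $\varphi:X\to\mathbb{C}$ such that for every $\mu\in\mathcal{M}$ there is a measurable function $\varphi_\mu$ that coincides with $\varphi$ $\mu$-a.e.; one puts $\int\varphi\,d\mu:=\int\varphi_\mu\,d\mu$. In particular bounded measurable functions belong to $L_\infty$. The operator $\mathcal{L}$ is extended to $L_\infty$ by $(\mathcal{L}\varphi)(x):=\int\varphi(y)\,P(x,dy)$ for all $x\in X$, $\varphi\in L_\infty$; it maps $L_\infty$ to itself. $\mathcal{L}^j$ is the $j$-th iterate of this extended operator ($\mathcal{L}^0$ is the identity). *)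

theory Defs
  imports "HOL-Probability.Probability"
begin

text \<open>
  A compact metric space is a type of class \<open>metric_space\<close> whose universe is compact.  Over such
  a type, \<open>'a \<Rightarrow>\<^sub>C complex\<close> consists of all continuous complex functions, and its norm is the
  supremum norm.  The library makes it a real vector space only; complex scalars are added here.
\<close>

definition scaleC_bcontfun ::
    "complex \<Rightarrow> ('a::topological_space \<Rightarrow>\<^sub>C complex) \<Rightarrow> ('a \<Rightarrow>\<^sub>C complex)"
  where "scaleC_bcontfun c f = Bcontfun (\<lambda>x. c * apply_bcontfun f x)"

lemma apply_scaleC_bcontfun:
  "apply_bcontfun (scaleC_bcontfun c f) x = c * apply_bcontfun f x"
proof -
  have "bounded ((\<lambda>z. c * z) ` range (apply_bcontfun f))"
    by (intro bounded_linear_image bounded_linear_mult_right bounded_apply_bcontfun)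
  then have "(\<lambda>x. c * apply_bcontfun f x) \<in> bcontfun"
    by (auto simp: bcontfun_def image_image intro!: continuous_intros)
  then show ?thesis
    by (simp add: scaleC_bcontfun_def Bcontfun_inverse)
qed

lemma vector_space_scaleC_bcontfun:
  "vector_space (scaleC_bcontfun :: complex \<Rightarrow> ('a::topological_space \<Rightarrow>\<^sub>C complex) \<Rightarrow> _)"
  by standard
    (auto intro!: bcontfun_eqI simp: apply_scaleC_bcontfun plus_bcontfun.rep_eq algebra_simps)

definition transfer_operator ::
    "(('a::metric_space \<Rightarrow>\<^sub>C complex) \<Rightarrow> ('a \<Rightarrow>\<^sub>C complex)) \<Rightarrow> bool"
  where "transfer_operator L \<longleftrightarrow>
    Vector_Spaces.linear scaleC_bcontfun scaleC_bcontfun L \<and>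
    (\<forall>f. (\<forall>x. apply_bcontfun f x \<in> \<real>\<^sub>\<ge>\<^sub>0) \<longrightarrow> (\<forall>x. apply_bcontfun (L f) x \<in> \<real>\<^sub>\<ge>\<^sub>0)) \<and>
    (\<forall>f. norm (L f) \<le> norm f) \<and>
    L (const_bcontfun 1) = const_bcontfun 1"

definition borel_prob_measures :: "'a::topological_space measure set"
  where "borel_prob_measures = {\<mu>. prob_space \<mu> \<and> sets \<mu> = sets borel}"

definition dual_transfer_operator ::
    "(('a::metric_space \<Rightarrow>\<^sub>C complex) \<Rightarrow> ('a \<Rightarrow>\<^sub>C complex)) \<Rightarrow> 'a measure \<Rightarrow> 'a measure"
  where "dual_transfer_operator L \<mu> =
    (THE \<nu>. \<nu> \<in> borel_prob_measures \<and>
      (\<forall>f. (\<integral>x. apply_bcontfun f x \<partial>\<nu>) = (\<integral>x. apply_bcontfun (L f) x \<partial>\<mu>)))"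

definition transition_prob ::
    "(('a::metric_space \<Rightarrow>\<^sub>C complex) \<Rightarrow> ('a \<Rightarrow>\<^sub>C complex)) \<Rightarrow> 'a \<Rightarrow> 'a measure"
  where "transition_prob L x =
    (THE \<nu>. \<nu> \<in> borel_prob_measures \<and>
      (\<forall>f. apply_bcontfun (L f) x = (\<integral>y. apply_bcontfun f y \<partial>\<nu>)))"

definition L_infty :: "('a::topological_space \<Rightarrow> complex) set"
  where "L_infty = {f. bounded (range f) \<and>
    (\<forall>\<mu>\<in>borel_prob_measures. \<exists>g\<in>borel_measurable borel. AE x in \<mu>. f x = g x)}"

text \<open>
  The integral of a member of \<open>L_infty\<close>, which need not be Borel measurable, is that of any Borel
  function agreeing with it almost everywhere; the choice does not affect the value.
\<close>

definition L_infty_integral :: "'a::topological_space measure \<Rightarrow> ('a \<Rightarrow> complex) \<Rightarrow> complex"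
  where "L_infty_integral \<mu> f =
    integral\<^sup>L \<mu> (SOME g. g \<in> borel_measurable borel \<and> (AE x in \<mu>. f x = g x))"

lemma L_infty_integral_eq:
  assumes \<mu>: "\<mu> \<in> borel_prob_measures" and g: "g \<in> borel_measurable borel"
    and ae: "AE x in \<mu>. f x = g x"
  shows "L_infty_integral \<mu> f = integral\<^sup>L \<mu> g"
proof -
  define h where "h = (SOME g. g \<in> borel_measurable borel \<and> (AE x in \<mu>. f x = g x))"
  have h: "h \<in> borel_measurable borel \<and> (AE x in \<mu>. f x = h x)"
    unfolding h_def by (rule someI[of _ g]) (use g ae in auto)
  have "sets \<mu> = sets borel"
    using \<mu> by (simp add: borel_prob_measures_def)
  then have "borel_measurable \<mu> = (borel_measurable borel :: ('a \<Rightarrow> complex) set)"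
    by (intro measurable_cong_sets) auto
  then have [measurable]: "h \<in> borel_measurable \<mu>" "g \<in> borel_measurable \<mu>"
    using h g by auto
  have "AE x in \<mu>. h x = g x"
    using h ae by auto
  then have "integral\<^sup>L \<mu> h = integral\<^sup>L \<mu> g"
    by (intro integral_cong_AE) auto
  then show ?thesis
    by (simp add: L_infty_integral_def h_def)
qed

definition extended_operator ::
    "(('a::metric_space \<Rightarrow>\<^sub>C complex) \<Rightarrow> ('a \<Rightarrow>\<^sub>C complex)) \<Rightarrow> ('a \<Rightarrow> complex) \<Rightarrow> 'a \<Rightarrow> complex"
  where "extended_operator L f x = L_infty_integral (transition_prob L x) f"

definition birkhoff_sum ::
    "(('a::metric_space \<Rightarrow>\<^sub>C complex) \<Rightarrow> ('a \<Rightarrow>\<^sub>C complex)) \<Rightarrow> ('a \<Rightarrow> complex) \<Rightarrow> nat \<Rightarrow> 'a \<Rightarrow> complex"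
  where "birkhoff_sum L f n x = (\<Sum>j<n. (extended_operator L ^^ j) f x)"

text \<open>
  For a bounded real \<open>\<phi>\<close> the sums below are real, so \<open>Re\<close> only changes the type; the averages are
  bounded by the bound of \<open>\<phi>\<close>, so the supremum over the reals is the actual one.
\<close>

definition superlevel_set ::
    "(('a::metric_space \<Rightarrow>\<^sub>C complex) \<Rightarrow> ('a \<Rightarrow>\<^sub>C complex)) \<Rightarrow> ('a \<Rightarrow> real) \<Rightarrow> real \<Rightarrow> 'a set"
  where "superlevel_set L \<phi> \<alpha> =
    {x. (SUP n\<in>{1..}. Re (birkhoff_sum L (\<lambda>y. complex_of_real (\<phi> y)) n x) / real n) > \<alpha>}"

end

theory Submission
  imports Defs
begin

text \<open>
  By the Riesz representation theorem, a transfer operator \<open>L\<close> is integration against a Markov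
  kernel \<open>P(x, dy)\<close>, and \<open>L\<^sup>*\<mu> = \<mu>\<close> says that \<open>\<mu>\<close> is stationary for this kernel.  The statement is then
  the maximal ergodic theorem of Hopf for the averaging operator \<open>T f (x) = \<integral> f(y) P(x, dy)\<close>,
  restricted to an invariant set.

  For the maximal ergodic theorem, subtract \<open>\<alpha>\<close> from \<open>\<phi>\<close> so that the level becomes \<open>0\<close>, and
  write \<open>\<phi>\<close> again for the difference.  Define
  \<open>g\<^sub>0 = 0\<close> and \<open>g\<^sub>n\<^sub>+\<^sub>1 = max(0, \<phi> + T g\<^sub>n)\<close>.  These functions increase with \<open>n\<close> and dominate the sums
  \<open>\<phi>\<^sub>n\<close>, and \<open>g\<^sub>n \<le> \<phi> + T g\<^sub>n\<close> wherever \<open>g\<^sub>n > 0\<close>.  If almost every point of \<open>A\<close> moves within \<open>A\<close> with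
  probability one, then \<open>T g\<^sub>n = T(\<chi>\<^sub>A g\<^sub>n)\<close> almost everywhere on \<open>A\<close>, and stationarity gives
  \<open>\<integral>\<^sub>A T g\<^sub>n d\<mu> \<le> \<integral>\<^sub>A g\<^sub>n d\<mu>\<close>.  Hence \<open>\<phi>\<close> has nonnegative integral over the part of \<open>A\<close> where \<open>g\<^sub>n > 0\<close>,
  and these parts exhaust \<open>A\<close> when \<open>A\<close> lies in the superlevel set (\<open>maximal_inequality\<close>).

  The transition probabilities and the dual operator are given by definite descriptions, so their
  properties rest on existence and uniqueness in the Riesz theorem (\<open>riesz_representation\<close>).
  Existence comes from an outer measure: an open set \<open>U\<close> has the supremum of the functional over
  continuous functions between \<open>0\<close> and the indicator of \<open>U\<close> as its content, and every set the
  infimum over its open neighbourhoods.  Compactness gives countable subadditivity, Caratheodory's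
  theorem gives the measure, and a layer-cake argument identifies its integrals.  Uniqueness, and the
  measurability of the kernel in \<open>x\<close>, follow since indicators of open sets are increasing limits of
  continuous functions.
\<close>

section \<open>The maximal inequality for an invariant Markov kernel\<close>

text \<open>
  The maximal ergodic theorem is a statement about a Markov kernel \<open>P\<close> and a probability measure
  \<open>M\<close> that it preserves.  Functions are pointwise bounded, not just
  essentially bounded, so that they are integrable against every single \<open>P x\<close> and the averaging
  operator is linear and monotone at every point.
\<close>

locale invariant_kernel = prob_space M
  for M :: "'a measure" +
  fixes P :: "'a \<Rightarrow> 'a measure"
  assumes kernel [measurable]: "P \<in> M \<rightarrow>\<^sub>M subprob_algebra M"
    and prob_space_kernel: "\<And>x. x \<in> space M \<Longrightarrow> prob_space (P x)"
    and invariant: "M \<bind> P = M"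
begin

definition average :: "('a \<Rightarrow> real) \<Rightarrow> 'a \<Rightarrow> real"
  where "average f x = (\<integral>y. f y \<partial>P x)"

definition bounded_measurable :: "('a \<Rightarrow> real) \<Rightarrow> bool"
  where "bounded_measurable f \<longleftrightarrow>
    f \<in> borel_measurable M \<and> (\<exists>B. \<forall>x\<in>space M. \<bar>f x\<bar> \<le> B)"

lemma sets_kernel_eq: "x \<in> space M \<Longrightarrow> sets (P x) = sets M"
  by (rule sets_kernel[OF kernel])

lemma space_kernel_eq: "x \<in> space M \<Longrightarrow> space (P x) = space M"
  by (rule sets_eq_imp_space_eq[OF sets_kernel_eq])

lemma bounded_measurable_imp_measurable: "bounded_measurable f \<Longrightarrow> f \<in> borel_measurable M"
  by (simp add: bounded_measurable_def)

lemma bounded_measurable_const: "bounded_measurable (\<lambda>x. c)"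
  by (auto simp: bounded_measurable_def)

lemma bounded_measurable_add:
  assumes "bounded_measurable f" "bounded_measurable g"
  shows "bounded_measurable (\<lambda>x. f x + g x)"
proof -
  obtain B C where "\<forall>x\<in>space M. \<bar>f x\<bar> \<le> B" "\<forall>x\<in>space M. \<bar>g x\<bar> \<le> C"
    using assms by (auto simp: bounded_measurable_def)
  then have "\<forall>x\<in>space M. \<bar>f x + g x\<bar> \<le> B + C"
    by (intro ballI order_trans[OF abs_triangle_ineq] add_mono) auto
  then show ?thesis
    using assms by (auto simp: bounded_measurable_def)
qed

lemma bounded_measurable_sum:
  "(\<And>i. i \<in> I \<Longrightarrow> bounded_measurable (f i)) \<Longrightarrow> bounded_measurable (\<lambda>x. \<Sum>i\<in>I. f i x)"
  by (induction I rule: infinite_finite_induct)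
    (auto intro: bounded_measurable_const bounded_measurable_add)

lemma bounded_measurable_max_zero:
  assumes "bounded_measurable f"
  shows "bounded_measurable (\<lambda>x. max 0 (f x))"
proof -
  obtain B where "\<forall>x\<in>space M. \<bar>f x\<bar> \<le> B"
    using assms by (auto simp: bounded_measurable_def)
  then have "\<forall>x\<in>space M. \<bar>max 0 (f x)\<bar> \<le> B"
    by (auto simp: max_def)
  then show ?thesis
    using assms by (auto simp: bounded_measurable_def)
qed

lemma bounded_measurable_indicator_mult:
  assumes "bounded_measurable f" "A \<in> sets M"
  shows "bounded_measurable (\<lambda>x. indicator A x * f x)"
proof -
  obtain B where "\<forall>x\<in>space M. \<bar>f x\<bar> \<le> B"
    using assms by (auto simp: bounded_measurable_def)
  then have "\<forall>x\<in>space M. \<bar>indicator A x * f x\<bar> \<le> B"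
    by (auto simp: indicator_def intro: order_trans[OF abs_ge_zero])
  then show ?thesis
    using assms by (auto simp: bounded_measurable_def)
qed

lemma integrable_bounded_measurable:
  assumes "bounded_measurable f"
  shows "integrable M f"
proof -
  obtain B where "\<forall>x\<in>space M. \<bar>f x\<bar> \<le> B"
    using assms by (auto simp: bounded_measurable_def)
  then show ?thesis
    using assms by (intro integrable_const_bound[of _ B]) (auto simp: bounded_measurable_def)
qed

lemma integrable_kernel:
  assumes "bounded_measurable f" "x \<in> space M"
  shows "integrable (P x) f"
proof -
  interpret P: prob_space "P x"
    using assms(2) by (rule prob_space_kernel)
  obtain B where "\<forall>x\<in>space M. \<bar>f x\<bar> \<le> B"
    using assms by (auto simp: bounded_measurable_def)
  moreover have "f \<in> borel_measurable (P x)"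
    using assms by (simp add: bounded_measurable_def cong: measurable_cong_sets[OF sets_kernel_eq])
  ultimately show ?thesis
    using space_kernel_eq[OF assms(2)] by (intro P.integrable_const_bound[of _ B]) auto
qed

lemma average_const: "x \<in> space M \<Longrightarrow> average (\<lambda>x. c) x = c"
  using prob_space.prob_space[OF prob_space_kernel] by (simp add: average_def)

lemma average_add:
  assumes "bounded_measurable f" "bounded_measurable g" "x \<in> space M"
  shows "average (\<lambda>x. f x + g x) x = average f x + average g x"
  unfolding average_def using assms by (intro Bochner_Integration.integral_add integrable_kernel)

lemma average_sum:
  assumes "\<And>i. i \<in> I \<Longrightarrow> bounded_measurable (f i)" "x \<in> space M"
  shows "average (\<lambda>x. \<Sum>i\<in>I. f i x) x = (\<Sum>i\<in>I. average (f i) x)"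
  unfolding average_def using assms by (intro Bochner_Integration.integral_sum integrable_kernel)

lemma average_cong:
  assumes "x \<in> space M" "\<And>y. y \<in> space M \<Longrightarrow> f y = g y"
  shows "average f x = average g x"
  unfolding average_def using assms space_kernel_eq
  by (intro Bochner_Integration.integral_cong) auto

lemma average_mono:
  assumes "bounded_measurable f" "bounded_measurable g" "x \<in> space M"
    and "\<And>y. y \<in> space M \<Longrightarrow> f y \<le> g y"
  shows "average f x \<le> average g x"
  unfolding average_def using assms space_kernel_eq
  by (intro integral_mono integrable_kernel) auto

lemma average_nonneg:
  assumes "x \<in> space M" "\<And>y. y \<in> space M \<Longrightarrow> 0 \<le> f y"
  shows "0 \<le> average f x"
  unfolding average_def using assms space_kernel_eq
  by (intro Bochner_Integration.integral_nonneg) auto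

text \<open>
  The averages lie between the averages of the two constant bounds; this makes the iterates of the
  averaging operator available.
\<close>

lemma bounded_measurable_average:
  assumes "bounded_measurable f"
  shows "bounded_measurable (average f)"
proof -
  obtain B where B: "\<forall>x\<in>space M. \<bar>f x\<bar> \<le> B"
    using assms by (auto simp: bounded_measurable_def)
  have "\<bar>average f x\<bar> \<le> B" if "x \<in> space M" for x
  proof -
    have "average f x \<le> average (\<lambda>x. B) x" "average (\<lambda>x. - B) x \<le> average f x"
      using B abs_le_iff by (intro average_mono assms bounded_measurable_const that; force)+
    then show ?thesis
      by (simp add: average_const that)
  qed
  moreover have "average f \<in> borel_measurable M"
    unfolding average_def
    using measurable_compose[OF kernel integral_measurable_subprob_algebra]
      bounded_measurable_imp_measurable[OF assms] by blast
  ultimately show ?thesis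
    by (auto simp: bounded_measurable_def)
qed

lemma bounded_measurable_funpow_average:
  "bounded_measurable f \<Longrightarrow> bounded_measurable ((average ^^ j) f)"
  by (induction j) (auto intro: bounded_measurable_average)

text \<open>
  This is where invariance enters: averaging preserves the integral because \<open>M \<bind> P = M\<close>.
\<close>

lemma integral_average:
  assumes "bounded_measurable f"
  shows "(\<integral>x. average f x \<partial>M) = (\<integral>x. f x \<partial>M)"
proof -
  obtain B where B: "\<forall>x\<in>space M. \<bar>f x\<bar> \<le> B"
    using assms by (auto simp: bounded_measurable_def)
  have "(\<integral>x. f x \<partial>(M \<bind> P)) = (\<integral>x. \<integral>y. f y \<partial>P x \<partial>M)"
  proof (rule integral_bind[where K = M and B = B and B' = 1])
    show "AE x in M. emeasure (P x) (space (P x)) \<le> ennreal 1"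
      using prob_space.emeasure_space_1[OF prob_space_kernel] by (intro AE_I2) auto
  qed (use B bounded_measurable_imp_measurable[OF assms] in \<open>auto intro: finite_measure_axioms\<close>)
  then show ?thesis
    by (simp add: invariant average_def)
qed

text \<open>
  The value of an optimal stopping problem: the largest expected sum of \<open>f\<close> along the Markov chain
  when one may stop at any of the times up to \<open>n\<close>.  It replaces the maximum of the first \<open>n\<close>
  iterated sums in Hopf's argument.  It dominates that maximum, and its recursion is exactly the
  inequality that the argument needs.
\<close>

primrec stopping_value :: "('a \<Rightarrow> real) \<Rightarrow> nat \<Rightarrow> 'a \<Rightarrow> real"
  where
    "stopping_value f 0 = (\<lambda>x. 0)"
  | "stopping_value f (Suc n) = (\<lambda>x. max 0 (f x + average (stopping_value f n) x))"

lemma stopping_value_nonneg: "0 \<le> stopping_value f n x"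
  by (cases n) auto

lemma bounded_measurable_stopping_value:
  "bounded_measurable f \<Longrightarrow> bounded_measurable (stopping_value f n)"
  by (induction n)
    (auto intro!: bounded_measurable_const bounded_measurable_max_zero bounded_measurable_add
      bounded_measurable_average)

lemma stopping_value_Suc_mono:
  assumes "bounded_measurable f" "x \<in> space M"
  shows "stopping_value f n x \<le> stopping_value f (Suc n) x"
  using assms(2)
proof (induction n arbitrary: x)
  case 0
  then show ?case by simp
next
  case (Suc n)
  have "average (stopping_value f n) x \<le> average (stopping_value f (Suc n)) x"
    by (intro average_mono bounded_measurable_stopping_value assms Suc)
  then show ?case
    by (simp add: max_def)
qed

lemma stopping_value_mono:
  assumes "bounded_measurable f" "x \<in> space M" "m \<le> n"
  shows "stopping_value f m x \<le> stopping_value f n x"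
  using assms(3) by (rule lift_Suc_mono_le[rotated]) (intro stopping_value_Suc_mono assms)

text \<open>
  Never stopping early is one admissible strategy.
\<close>

lemma average_sums_le_stopping_value:
  assumes "bounded_measurable f" "x \<in> space M"
  shows "(\<Sum>j<n. (average ^^ j) f x) \<le> stopping_value f n x"
  using assms(2)
proof (induction n arbitrary: x)
  case 0
  then show ?case by simp
next
  case (Suc n)
  have "(\<Sum>j<Suc n. (average ^^ j) f x) = f x + (\<Sum>j<n. average ((average ^^ j) f) x)"
    by (subst sum.lessThan_Suc_shift) simp
  also have "\<dots> = f x + average (\<lambda>x. \<Sum>j<n. (average ^^ j) f x) x"
    using assms Suc.prems by (subst average_sum) (auto intro: bounded_measurable_funpow_average)
  also have "\<dots> \<le> f x + average (stopping_value f n) x"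
    using assms Suc
    by (intro add_left_mono average_mono bounded_measurable_sum bounded_measurable_funpow_average
        bounded_measurable_stopping_value) auto
  also have "\<dots> \<le> stopping_value f (Suc n) x"
    by simp
  finally show ?case .
qed

text \<open>
  Where the value is positive, the maximum in the recursion is attained by its second term, and
  monotonicity in the horizon allows the same horizon on both sides.
\<close>

lemma stopping_value_le:
  assumes "bounded_measurable f" "x \<in> space M" "0 < stopping_value f n x"
  shows "stopping_value f n x \<le> f x + average (stopping_value f n) x"
proof (cases n)
  case 0
  with assms show ?thesis by simp
next
  case (Suc m)
  then have "stopping_value f n x = f x + average (stopping_value f m) x"
    using assms(3) by (auto simp: max_def split: if_splits)
  moreover have "average (stopping_value f m) x \<le> average (stopping_value f n) x"
    unfolding Suc
    by (intro average_mono bounded_measurable_stopping_value stopping_value_Suc_mono assms)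
  ultimately show ?thesis
    by simp
qed

text \<open>
  From an absorbed point of \<open>A\<close> the next step stays in \<open>A\<close> almost surely, so averaging before or after cutting
  off outside \<open>A\<close> gives the same result there; elsewhere the left-hand side vanishes.
\<close>

lemma indicator_average_le:
  assumes f: "bounded_measurable f" "\<And>x. x \<in> space M \<Longrightarrow> 0 \<le> f x" and A: "A \<in> sets M"
    and x: "x \<in> space M" and absorbing: "x \<in> A \<Longrightarrow> measure (P x) A = 1"
  shows "indicator A x * average f x \<le> average (\<lambda>y. indicator A y * f y) x"
proof (cases "x \<in> A")
  case True
  interpret P: prob_space "P x"
    using x by (rule prob_space_kernel)
  have "AE y in P x. y \<in> A"
    using P.prob_eq_1[of A] absorbing[OF True] A sets_kernel_eq[OF x] by simp
  then have "average f x = average (\<lambda>y. indicator A y * f y) x"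
    unfolding average_def
    using integrable_kernel[OF f(1) x]
      integrable_kernel[OF bounded_measurable_indicator_mult[OF f(1) A] x]
    by (intro integral_cong_AE) (auto simp: indicator_def dest: borel_measurable_integrable)
  then show ?thesis
    using True by simp
next
  case False
  then show ?thesis
    using f(2) x by (auto intro!: average_nonneg)
qed

text \<open>
  Hopf's argument, localised to an absorbing set.  Let \<open>g\<close> be the stopping value with horizon \<open>n\<close>
  and \<open>E\<close> the part of \<open>A\<close> where \<open>g > 0\<close>.  On \<open>E\<close> one has \<open>f \<ge> g - average g\<close>, and on the rest of
  \<open>A\<close> the right-hand side is at most \<open>0\<close>; so the integral of \<open>f\<close> over \<open>E\<close> is at least that of
  \<open>g - average g\<close> over \<open>A\<close>.  The latter is nonnegative, because \<open>A\<close> is absorbing up to a null set and the integral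
  is invariant under averaging.  As \<open>n\<close> grows, the sets \<open>E\<close> exhaust \<open>A\<close>.
\<close>

theorem maximal_inequality:
  assumes f: "bounded_measurable f" and A: "A \<in> sets M"
    and absorbing: "AE x in M. x \<in> A \<longrightarrow> measure (P x) A = 1"
    and gain: "\<And>x. x \<in> A \<Longrightarrow> \<exists>n. 0 < (\<Sum>j<n. (average ^^ j) f x)"
  shows "0 \<le> (\<integral>x\<in>A. f x \<partial>M)"
proof -
  define E where "E = (\<lambda>n. {x \<in> space M. x \<in> A \<and> 0 < stopping_value f n x})"
  note gain_bm = bounded_measurable_stopping_value[OF f]
  note [measurable] = A bounded_measurable_imp_measurable[OF gain_bm]
    bounded_measurable_imp_measurable[OF f]
  have E [measurable]: "E n \<in> sets M" for n
    unfolding E_def by measurable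
  \<comment> \<open>Hopf's inequality for a fixed horizon, before passing to the limit.\<close>
  have E_nonneg: "0 \<le> (\<integral>x. indicator (E n) x * f x \<partial>M)" for n
  proof -
    let ?g = "stopping_value f n"
    have int: "integrable M (\<lambda>x. indicator A x * ?g x)"
      "integrable M (\<lambda>x. indicator A x * average ?g x)"
      "integrable M (\<lambda>x. average (\<lambda>x. indicator A x * ?g x) x)"
      "integrable M (\<lambda>x. indicator (E n) x * f x)"
      by (intro integrable_bounded_measurable bounded_measurable_indicator_mult
          bounded_measurable_average gain_bm A E f)+
    have "(\<integral>x. indicator A x * average ?g x \<partial>M)
        \<le> (\<integral>x. average (\<lambda>x. indicator A x * ?g x) x \<partial>M)"
    proof (rule integral_mono_AE[OF int(2,3)])
      show "AE x in M. indicator A x * average ?g x \<le> average (\<lambda>x. indicator A x * ?g x) x"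
        using absorbing AE_space
        by eventually_elim (intro indicator_average_le gain_bm stopping_value_nonneg A; auto)
    qed
    also have "\<dots> = (\<integral>x. indicator A x * ?g x \<partial>M)"
      by (intro integral_average bounded_measurable_indicator_mult gain_bm A)
    finally have "0 \<le> (\<integral>x. indicator A x * ?g x - indicator A x * average ?g x \<partial>M)"
      by (simp add: int)
    also have "\<dots> \<le> (\<integral>x. indicator (E n) x * f x \<partial>M)"
    proof (rule integral_mono)
      fix x assume x: "x \<in> space M"
      show "indicator A x * ?g x - indicator A x * average ?g x \<le> indicator (E n) x * f x"
        using stopping_value_le[OF f x, of n] stopping_value_nonneg[of f n x]
          average_nonneg[OF x, of ?g] stopping_value_nonneg[of f n] x
        by (cases "x \<in> A"; cases "0 < ?g x") (auto simp: E_def)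
    qed (use int in auto)
    finally show ?thesis .
  qed
  obtain B where B: "\<forall>x\<in>space M. \<bar>f x\<bar> \<le> B"
    using f by (auto simp: bounded_measurable_def)
  \<comment> \<open>A point of \<open>A\<close> belongs to all \<open>E n\<close> from the index at which one of its sums is positive.\<close>
  have "(\<lambda>n. \<integral>x. indicator (E n) x * f x \<partial>M) \<longlonglongrightarrow> (\<integral>x. indicator A x * f x \<partial>M)"
  proof (rule integral_dominated_convergence[where w = "\<lambda>x. B"])
    show "AE x in M. (\<lambda>n. indicator (E n) x * f x) \<longlonglongrightarrow> indicator A x * f x"
    proof (rule AE_I2)
      fix x assume x: "x \<in> space M"
      have "\<forall>\<^sub>F n in sequentially. indicator (E n) x = (indicator A x :: real)"
      proof (cases "x \<in> A")
        case True
        then obtain N where "0 < (\<Sum>j<N. (average ^^ j) f x)"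
          using gain by blast
        then have N: "0 < stopping_value f N x"
          using average_sums_le_stopping_value[OF f x, of N] by simp
        show ?thesis
          using eventually_ge_at_top[of N]
        proof eventually_elim
          case (elim n)
          then show ?case
            using stopping_value_mono[OF f x elim] N True x by (simp add: E_def)
        qed
      next
        case False
        then show ?thesis
          by (simp add: E_def)
      qed
      then show "(\<lambda>n. indicator (E n) x * f x) \<longlonglongrightarrow> indicator A x * f x"
        by (intro tendsto_eventually) (auto elim: eventually_mono)
    qed
    show "AE x in M. norm (indicator (E n) x * f x) \<le> B" for n
      using B by (intro AE_I2) (auto simp: indicator_def intro: order_trans[OF abs_ge_zero])
  qed auto
  then have "0 \<le> (\<integral>x. indicator A x * f x \<partial>M)"
    using E_nonneg by (intro LIMSEQ_le_const) auto
  then show ?thesis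
    by (simp add: set_lebesgue_integral_def)
qed

text \<open>
  Averaging fixes constants, so subtracting \<open>c\<close> from \<open>f\<close> subtracts \<open>n * c\<close> from its \<open>n\<close>-th iterated
  sum, and the level \<open>c\<close> becomes the level \<open>0\<close>.
\<close>

corollary maximal_inequality_level:
  assumes f: "bounded_measurable f" and A: "A \<in> sets M"
    and absorbing: "AE x in M. x \<in> A \<longrightarrow> measure (P x) A = 1"
    and level: "\<And>x. x \<in> A \<Longrightarrow> \<exists>n\<ge>1. c < (\<Sum>j<n. (average ^^ j) f x) / real n"
  shows "c * measure M A \<le> (\<integral>x\<in>A. f x \<partial>M)"
proof -
  define h where "h = (\<lambda>x. f x + (- c))"
  have h: "bounded_measurable h"
    unfolding h_def by (intro bounded_measurable_add bounded_measurable_const f)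
  have iterate: "(average ^^ j) h x = (average ^^ j) f x - c" if "x \<in> space M" for j x
    using that
  proof (induction j arbitrary: x)
    case 0
    then show ?case
      by (simp add: h_def)
  next
    case (Suc j)
    have "average ((average ^^ j) h) x = average (\<lambda>x. (average ^^ j) f x + (- c)) x"
      using Suc by (intro average_cong) auto
    also have "\<dots> = average ((average ^^ j) f) x - c"
      using Suc.prems f
      by (simp only: average_add bounded_measurable_funpow_average bounded_measurable_const
          average_const diff_conv_add_uminus)
    finally show ?case
      by simp
  qed
  have "0 \<le> (\<integral>x\<in>A. h x \<partial>M)"
  proof (rule maximal_inequality[OF h A absorbing])
    fix x assume "x \<in> A"
    then obtain n where n: "n \<ge> 1" "c < (\<Sum>j<n. (average ^^ j) f x) / real n"
      using level by blast
    have "x \<in> space M"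
      using \<open>x \<in> A\<close> A sets.sets_into_space by blast
    then have "(\<Sum>j<n. (average ^^ j) h x) = (\<Sum>j<n. (average ^^ j) f x) - real n * c"
      by (simp add: iterate sum_subtractf)
    also have "\<dots> > 0"
      using n by (simp add: field_simps)
    finally show "\<exists>n. 0 < (\<Sum>j<n. (average ^^ j) h x)"
      by blast
  qed
  also have "(\<integral>x\<in>A. h x \<partial>M) = (\<integral>x. indicator A x * f x + - c * indicator A x \<partial>M)"
    by (simp add: set_lebesgue_integral_def h_def algebra_simps)
  also have "\<dots> = (\<integral>x. indicator A x * f x \<partial>M) + (\<integral>x. - c * indicator A x \<partial>M)"
  proof (rule Bochner_Integration.integral_add)
    show "integrable M (\<lambda>x. indicator A x * f x)"
      by (intro integrable_bounded_measurable bounded_measurable_indicator_mult f A)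
    show "integrable M (\<lambda>x. - c * indicator A x)"
      using A by (intro integrable_mult_right) (simp add: emeasure_eq_measure)
  qed
  also have "\<dots> = (\<integral>x\<in>A. f x \<partial>M) - c * measure M A"
    using A by (simp add: set_lebesgue_integral_def)
  finally show ?thesis
    by simp
qed

end

section \<open>Indicators of open sets as limits of continuous functions\<close>

definition continuous_increasing_to_indicator ::
    "(nat \<Rightarrow> 'a::topological_space \<Rightarrow> real) \<Rightarrow> 'a set \<Rightarrow> bool"
  where "continuous_increasing_to_indicator g U \<longleftrightarrow>
    (\<forall>k. continuous_on UNIV (g k)) \<and> (\<forall>k x. 0 \<le> g k x) \<and> (\<forall>k x. g k x \<le> indicator U x) \<and>
    (\<forall>j k x. j \<le> k \<longrightarrow> g j x \<le> g k x) \<and> (\<forall>x. (\<lambda>k. g k x) \<longlonglongrightarrow> indicator U x)"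

lemma continuous_increasing_to_indicatorD:
  assumes "continuous_increasing_to_indicator g U"
  shows "continuous_on UNIV (g k)" "0 \<le> g k x" "g k x \<le> indicator U x"
    "j \<le> k \<Longrightarrow> g j x \<le> g k x" "(\<lambda>k. g k x) \<longlonglongrightarrow> indicator U x"
  using assms by (auto simp: continuous_increasing_to_indicator_def)

text \<open>
  The functions \<open>min 1 (k * d)\<close> work, where \<open>d\<close> is the distance to the complement.  The whole space
  is a separate case because \<open>infdist\<close> to the empty set is \<open>0\<close>.
\<close>

lemma open_indicator_approximation:
  fixes U :: "'a::metric_space set"
  assumes "open U"
  shows "\<exists>g. continuous_increasing_to_indicator g U"
proof (cases "U = UNIV")
  case True
  then have "continuous_increasing_to_indicator (\<lambda>_ _. 1) U"
    by (simp add: continuous_increasing_to_indicator_def)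
  then show ?thesis
    by blast
next
  case False
  define g where "g = (\<lambda>(k::nat) x. min 1 (real k * infdist x (- U)))"
  have zero: "infdist x (- U) = 0" if "x \<notin> U" for x
    using that by simp
  have pos: "infdist x (- U) > 0" if "x \<in> U" for x
    using that False assms infdist_pos_not_in_closed[of "- U"] by auto
  have "continuous_increasing_to_indicator g U"
    unfolding continuous_increasing_to_indicator_def
  proof (intro conjI allI impI)
    show "continuous_on UNIV (g k)" for k
      unfolding g_def by (intro continuous_intros)
    show "0 \<le> g k x" for k x
      by (simp add: g_def infdist_nonneg)
    show "g k x \<le> indicator U x" for k x
      using zero[of x] by (auto simp: g_def indicator_def)
    show "g j x \<le> g k x" if "j \<le> k" for j k x
      using that unfolding g_def
      by (intro min.mono order_refl mult_right_mono) (auto simp: infdist_nonneg)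
    show "(\<lambda>k. g k x) \<longlonglongrightarrow> indicator U x" for x
    proof (cases "x \<in> U")
      case True
      obtain K :: nat where K: "real K * infdist x (- U) > 1"
        using reals_Archimedean3[OF pos[OF True]] by blast
      have "\<forall>\<^sub>F k in sequentially. g k x = 1"
        using eventually_ge_at_top[of K]
      proof eventually_elim
        case (elim k)
        have "real K * infdist x (- U) \<le> real k * infdist x (- U)"
          using elim by (intro mult_right_mono) (auto simp: infdist_nonneg)
        then show ?case
          using K by (simp add: g_def)
      qed
      then show ?thesis
        using True by (simp add: tendsto_eventually)
    next
      case False
      then show ?thesis
        by (simp add: g_def)
    qed
  qed
  then show ?thesis
    by blast
qed

section \<open>The Riesz representation theorem on a compact metric space\<close>

text \<open>
  This identity and the following estimate concern the layers of height one of a number \<open>t\<close>: the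
  clamped differences add up to \<open>t\<close> (up to \<open>m\<close>), and the number of layers that \<open>t\<close> enters exceeds
  \<open>t\<close> by at most one.
\<close>

lemma sum_clamp_eq:
  fixes t :: real
  assumes "0 \<le> t"
  shows "(\<Sum>k<m. min (max (t - real k) 0) 1) = min t (real m)"
  using assms by (induction m) (auto simp: min_def max_def)

lemma sum_indicator_less_le:
  fixes t :: real
  assumes "0 \<le> t"
  shows "(\<Sum>k<m. if real k < t then 1 else 0) \<le> min (real m) (t + 1)"
proof (induction m)
  case 0
  with assms show ?case
    by simp
next
  case (Suc m)
  then show ?case
    unfolding sum.lessThan_Suc by (cases "real m < t") auto
qed

text \<open>
  The functional is defined on all real functions, but only its values on continuous ones are
  constrained.  This avoids a separate type for the continuous functions.
\<close>

locale positive_normalized_functional =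
  fixes \<Lambda> :: "('a::metric_space \<Rightarrow> real) \<Rightarrow> real"
  assumes compact_space: "compact (UNIV :: 'a set)"
    and additive: "\<And>f g. continuous_on UNIV f \<Longrightarrow> continuous_on UNIV g \<Longrightarrow>
      \<Lambda> (\<lambda>x. f x + g x) = \<Lambda> f + \<Lambda> g"
    and homogeneous: "\<And>f c. continuous_on UNIV f \<Longrightarrow> \<Lambda> (\<lambda>x. c * f x) = c * \<Lambda> f"
    and positive: "\<And>f. continuous_on UNIV f \<Longrightarrow> (\<And>x. 0 \<le> f x) \<Longrightarrow> 0 \<le> \<Lambda> f"
    and normalized: "\<Lambda> (\<lambda>x. 1) = 1"
begin

lemma functional_const: "\<Lambda> (\<lambda>x. c) = c"
  using homogeneous[of "\<lambda>x. 1" c] normalized by simp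

lemma functional_mono:
  assumes "continuous_on UNIV f" "continuous_on UNIV g" "\<And>x. f x \<le> g x"
  shows "\<Lambda> f \<le> \<Lambda> g"
proof -
  have "\<Lambda> (\<lambda>x. g x + (- 1) * f x) = \<Lambda> g + \<Lambda> (\<lambda>x. (- 1) * f x)"
    by (intro additive continuous_intros assms)
  also have "\<Lambda> (\<lambda>x. (- 1) * f x) = (- 1) * \<Lambda> f"
    by (intro homogeneous assms)
  finally have "\<Lambda> (\<lambda>x. g x + (- 1) * f x) = \<Lambda> g - \<Lambda> f"
    by simp
  moreover have "0 \<le> \<Lambda> (\<lambda>x. g x + (- 1) * f x)"
    using assms by (intro positive continuous_intros) auto
  ultimately show ?thesis
    by simp
qed

lemma functional_sum:
  assumes "\<And>i. i \<in> I \<Longrightarrow> continuous_on UNIV (f i)" "finite I"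
  shows "\<Lambda> (\<lambda>x. \<Sum>i\<in>I. f i x) = (\<Sum>i\<in>I. \<Lambda> (f i))"
  using assms(2,1)
proof (induction I)
  case empty
  then show ?case
    using functional_const[of 0] by simp
next
  case (insert i I)
  then have "\<Lambda> (\<lambda>x. f i x + (\<Sum>i\<in>I. f i x)) = \<Lambda> (f i) + \<Lambda> (\<lambda>x. \<Sum>i\<in>I. f i x)"
    by (intro additive continuous_intros) auto
  with insert show ?case
    by simp
qed

text \<open>
  An open set is measured by the functional on the
  continuous functions below its indicator, an arbitrary set by the open sets around it.
  Functions below the indicator need not have their support inside the open set; this is corrected,
  where it matters, by subtracting a small constant and cutting off at zero.
\<close>

definition inner_functions :: "'a set \<Rightarrow> ('a \<Rightarrow> real) set"
  where "inner_functions U =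
    {f. continuous_on UNIV f \<and> (\<forall>x. 0 \<le> f x) \<and> (\<forall>x. f x \<le> indicator U x)}"

definition inner_content :: "'a set \<Rightarrow> ennreal"
  where "inner_content U = (SUP f\<in>inner_functions U. ennreal (\<Lambda> f))"

definition outer_content :: "'a set \<Rightarrow> ennreal"
  where "outer_content A = (INF U\<in>{U. open U \<and> A \<subseteq> U}. inner_content U)"

lemma zero_inner_function: "(\<lambda>x. 0) \<in> inner_functions U"
  by (simp add: inner_functions_def)

lemma functional_le_inner_content:
  "f \<in> inner_functions U \<Longrightarrow> ennreal (\<Lambda> f) \<le> inner_content U"
  unfolding inner_content_def by (rule SUP_upper)

lemma inner_content_mono:
  assumes "U \<subseteq> V"
  shows "inner_content U \<le> inner_content V"
  unfolding inner_content_def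
proof (rule SUP_subset_mono)
  have "(indicator U x :: real) \<le> indicator V x" for x
    using assms by (auto simp: indicator_def)
  then show "inner_functions U \<subseteq> inner_functions V"
    unfolding inner_functions_def by (auto intro: order_trans)
qed simp

lemma inner_content_empty: "inner_content {} = 0"
proof -
  have "inner_functions {} = {\<lambda>x. 0}"
    by (auto simp: inner_functions_def intro!: ext antisym)
  then show ?thesis
    by (simp add: inner_content_def functional_const)
qed

lemma inner_content_UNIV: "inner_content UNIV = 1"
proof (rule antisym)
  show "inner_content UNIV \<le> 1"
    unfolding inner_content_def
  proof (rule SUP_least)
    fix f :: "'a \<Rightarrow> real"
    assume "f \<in> inner_functions UNIV"
    then have "\<Lambda> f \<le> \<Lambda> (\<lambda>x. 1)"
      by (intro functional_mono) (auto simp: inner_functions_def)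
    then show "ennreal (\<Lambda> f) \<le> 1"
      by (simp add: normalized)
  qed
  have "(\<lambda>x. 1) \<in> inner_functions UNIV"
    by (simp add: inner_functions_def)
  then show "1 \<le> inner_content UNIV"
    using functional_le_inner_content[of "\<lambda>x. 1" UNIV] by (simp add: normalized)
qed

text \<open>
  Given a continuous \<open>f\<close> below the indicator of the union, the sums \<open>h k\<close> of the first \<open>k\<close>
  approximating functions increase, with a limit that is at least \<open>f\<close>.  As in Dini's theorem,
  compactness turns this into \<open>f \<le> h k + e\<close> everywhere for a single \<open>k\<close>, and finite additivity of
  the functional finishes the proof.
\<close>

lemma inner_content_countably_subadditive:
  assumes "\<And>i. open (U i)"
  shows "inner_content (\<Union>i. U i) \<le> (\<Sum>i. inner_content (U i))"
  unfolding inner_content_def[of "\<Union>i. U i"]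
proof (rule SUP_least, rule ennreal_le_epsilon)
  fix f :: "'a \<Rightarrow> real" and e :: real
  assume "f \<in> inner_functions (\<Union>i. U i)" and "0 < e"
  then have f: "continuous_on UNIV f" "\<And>x. 0 \<le> f x" "\<And>x. f x \<le> indicator (\<Union>i. U i) x"
    by (auto simp: inner_functions_def)
  obtain g where "\<And>i. continuous_increasing_to_indicator (g i) (U i)"
    using open_indicator_approximation[OF assms] by metis
  note g = continuous_increasing_to_indicatorD[OF this]
  define h where "h = (\<lambda>k x. \<Sum>i<k. g i k x)"
  have h_cont: "continuous_on UNIV (h k)" for k
    unfolding h_def by (intro continuous_intros g)
  have h_mono: "h j x \<le> h k x" if "j \<le> k" for j k x
  proof -
    have "(\<Sum>i<j. g i j x) \<le> (\<Sum>i<j. g i k x)"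
      by (intro sum_mono g that)
    also have "\<dots> \<le> (\<Sum>i<k. g i k x)"
      using that by (intro sum_mono2 g) auto
    finally show ?thesis
      by (simp add: h_def)
  qed
  define W where "W = (\<lambda>k. {x. f x < h k x + e})"
  have "open (W k)" for k
    unfolding W_def by (intro open_Collect_less continuous_intros f h_cont)
  moreover have "UNIV \<subseteq> (\<Union>k\<in>UNIV. W k)"
  proof
    fix x
    show "x \<in> (\<Union>k\<in>UNIV. W k)"
    proof (cases "x \<in> (\<Union>i. U i)")
      case True
      then obtain i where i: "x \<in> U i"
        by blast
      have "(\<lambda>k. g i k x) \<longlonglongrightarrow> 1"
        using g(5)[of i x] i by simp
      then have "\<forall>\<^sub>F k in sequentially. 1 - e < g i k x"
        using \<open>0 < e\<close> by (intro order_tendstoD) auto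
      then have "\<forall>\<^sub>F k in sequentially. 1 - e < g i k x \<and> i < k"
        using eventually_gt_at_top[of i] by eventually_elim auto
      then obtain k where k: "1 - e < g i k x" "i < k"
        by (auto simp: eventually_sequentially)
      have "g i k x \<le> h k x"
        unfolding h_def using k g by (intro member_le_sum) auto
      then show ?thesis
        using k f(3)[of x] True by (auto simp: W_def intro!: exI[of _ k])
    next
      case False
      then have "f x \<le> 0"
        using f(3)[of x] by (simp add: indicator_def)
      moreover have "0 \<le> h 0 x"
        by (simp add: h_def)
      ultimately show ?thesis
        using \<open>0 < e\<close> by (auto simp: W_def intro!: exI[of _ 0])
    qed
  qed
  ultimately obtain K where K: "finite K" "UNIV \<subseteq> (\<Union>k\<in>K. W k)"
    using compactE_image[OF compact_space, of UNIV W] by auto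
  obtain k where k: "\<And>j. j \<in> K \<Longrightarrow> j \<le> k"
    using K(1) finite_nat_set_iff_bounded_le by auto
  have le: "f x \<le> h k x + e" for x
  proof -
    obtain j where "j \<in> K" "x \<in> W j"
      using K(2) by blast
    then show ?thesis
      using h_mono[OF k, of j x] by (simp add: W_def)
  qed
  have "\<Lambda> f \<le> \<Lambda> (\<lambda>x. h k x + e)"
    using le by (intro functional_mono continuous_intros f h_cont)
  also have "\<dots> = \<Lambda> (h k) + e"
    using additive[OF h_cont, of "\<lambda>x. e" k] by (simp add: functional_const)
  also have "\<Lambda> (h k) = (\<Sum>i<k. \<Lambda> (g i k))"
    unfolding h_def by (intro functional_sum g) simp
  finally have "ennreal (\<Lambda> f) \<le> ennreal ((\<Sum>i<k. \<Lambda> (g i k)) + e)"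
    by (rule ennreal_leI)
  also have "\<dots> = (\<Sum>i<k. ennreal (\<Lambda> (g i k))) + ennreal e"
  proof -
    have nonneg: "0 \<le> \<Lambda> (g i k)" for i
      by (intro positive g)
    then have "(\<Sum>i<k. ennreal (\<Lambda> (g i k))) = ennreal (\<Sum>i<k. \<Lambda> (g i k))"
      by (intro sum_ennreal)
    then show ?thesis
      using \<open>0 < e\<close> nonneg by (simp add: sum_nonneg)
  qed
  also have "(\<Sum>i<k. ennreal (\<Lambda> (g i k))) \<le> (\<Sum>i<k. inner_content (U i))"
    by (intro sum_mono functional_le_inner_content) (simp add: inner_functions_def g)
  also have "\<dots> \<le> (\<Sum>i. inner_content (U i))"
    by (intro sum_le_suminf) auto
  finally show "ennreal (\<Lambda> f) \<le> (\<Sum>i. inner_content (U i)) + ennreal e"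
    by (simp add: add_right_mono)
qed

lemma outer_content_le: "open U \<Longrightarrow> A \<subseteq> U \<Longrightarrow> outer_content A \<le> inner_content U"
  unfolding outer_content_def by (rule INF_lower) simp

lemma outer_content_open: "open U \<Longrightarrow> outer_content U = inner_content U"
  by (intro antisym outer_content_le)
    (auto simp: outer_content_def intro!: INF_greatest inner_content_mono)

lemma outer_content_mono: "A \<subseteq> B \<Longrightarrow> outer_content A \<le> outer_content B"
  unfolding outer_content_def by (rule INF_superset_mono) auto

text \<open>
  Every set is covered by an open set of nearly the same content, with errors \<open>e / 2 ^ (i + 1)\<close>
  that add up to \<open>e\<close>.
\<close>

lemma outer_content_countably_subadditive:
  "outer_content (\<Union>i. A i) \<le> (\<Sum>i::nat. outer_content (A i))"
proof (rule ennreal_le_epsilon)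
  fix e :: real
  assume "0 < e"
  have "outer_content B \<noteq> \<infinity>" for B
  proof -
    have "outer_content B \<le> 1"
      using outer_content_mono[of B UNIV] by (simp add: outer_content_open inner_content_UNIV)
    then show ?thesis
      by (auto simp: top_unique)
  qed
  then have "\<exists>U\<in>{U. open U \<and> A i \<subseteq> U}. inner_content U < outer_content (A i) + ennreal (e * (1/2) ^ Suc i)" for i
    using \<open>0 < e\<close> by (intro INF_approx_ennreal) (auto simp: outer_content_def)
  then obtain U where U: "\<And>i. open (U i)" "\<And>i. A i \<subseteq> U i"
    "\<And>i. inner_content (U i) < outer_content (A i) + ennreal (e * (1/2) ^ Suc i)"
    by (metis (mono_tags, lifting) mem_Collect_eq)
  have "outer_content (\<Union>i. A i) \<le> inner_content (\<Union>i. U i)"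
    using U by (intro outer_content_le) auto
  also have "\<dots> \<le> (\<Sum>i. inner_content (U i))"
    by (intro inner_content_countably_subadditive U)
  also have "\<dots> \<le> (\<Sum>i. outer_content (A i) + ennreal (e * (1/2) ^ Suc i))"
    by (intro suminf_le less_imp_le U) auto
  also have "\<dots> = (\<Sum>i. outer_content (A i)) + (\<Sum>i. ennreal e * ennreal ((1/2) ^ Suc i))"
    using \<open>0 < e\<close>
    by (subst suminf_add[symmetric])
      (auto simp del: ennreal_suminf_cmult simp add: ennreal_mult[symmetric])
  also have "\<dots> = (\<Sum>i. outer_content (A i)) + e"
    unfolding ennreal_suminf_cmult
    by (subst suminf_ennreal_eq[OF zero_le_power power_half_series]) auto
  finally show "outer_content (\<Union>i. A i) \<le> (\<Sum>i. outer_content (A i)) + ennreal e" .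
qed

lemma outer_measure_space_outer_content: "outer_measure_space (Pow UNIV) outer_content"
proof -
  have "outer_content {} = 0"
    by (simp add: outer_content_open inner_content_empty)
  then show ?thesis
    by (auto simp: outer_measure_space_def positive_def increasing_def countably_subadditive_def
        intro: outer_content_mono outer_content_countably_subadditive)
qed

lemma outer_content_subadditive: "outer_content (A \<union> B) \<le> outer_content A + outer_content B"
proof -
  define C where "C = (\<lambda>i::nat. if i = 0 then A else if i = 1 then B else {})"
  have "outer_content (A \<union> B) = outer_content (\<Union>i. C i)"
    by (rule arg_cong[of _ _ outer_content]) (auto simp: C_def split: if_splits)
  also have "\<dots> \<le> (\<Sum>i. outer_content (C i))"
    by (rule outer_content_countably_subadditive)
  also have "\<dots> = (\<Sum>i\<in>{0,1}. outer_content (C i))"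
    by (rule suminf_finite) (auto simp: C_def outer_content_open inner_content_empty)
  finally show ?thesis
    by (simp add: C_def)
qed

text \<open>
  The metric form of additivity.  A function \<open>f\<close> below the indicator of \<open>V \<inter> U\<close> and a function \<open>g\<close>
  living near \<open>V - U\<close> can be added without exceeding the indicator of \<open>V\<close> once \<open>f\<close> is lowered by
  \<open>e\<close>: the open set \<open>W\<close> where \<open>f < e\<close> then contains \<open>V - U\<close> and avoids the support of the lowered
  function.
\<close>

lemma inner_content_split:
  assumes "open U" "open V"
  shows "inner_content (V \<inter> U) + outer_content (V - U) \<le> inner_content V"
proof -
  have "ennreal (\<Lambda> f) + outer_content (V - U) \<le> inner_content V"
    if "f \<in> inner_functions (V \<inter> U)" for f
  proof (rule ennreal_le_epsilon)
    fix e :: real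
    assume "0 < e"
    have f: "continuous_on UNIV f" "\<And>x. 0 \<le> f x" "\<And>x. f x \<le> indicator (V \<inter> U) x"
      using that by (auto simp: inner_functions_def)
    define f' where "f' = (\<lambda>x. max 0 (f x - e))"
    define W where "W = V \<inter> {x. f x < e}"
    have f': "continuous_on UNIV f'" "\<And>x. 0 \<le> f' x"
      unfolding f'_def by (auto intro!: continuous_intros f)
    have "open W"
      unfolding W_def by (intro open_Int assms open_Collect_less continuous_intros f)
    moreover have "V - U \<subseteq> W"
    proof
      fix x assume "x \<in> V - U"
      then show "x \<in> W"
        using f(3)[of x] \<open>0 < e\<close> by (auto simp: W_def)
    qed
    ultimately have W: "outer_content (V - U) \<le> inner_content W"
      by (rule outer_content_le)
    have sum: "ennreal (\<Lambda> f') + ennreal (\<Lambda> g) \<le> inner_content V" if "g \<in> inner_functions W" for g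
    proof -
      have g: "continuous_on UNIV g" "\<And>x. 0 \<le> g x" "\<And>x. g x \<le> indicator W x"
        using that by (auto simp: inner_functions_def)
      have "f' x + g x \<le> indicator V x" for x
        using g(2,3)[of x] f(2,3)[of x] \<open>0 < e\<close>
        by (cases "x \<in> W"; cases "x \<in> V"; cases "x \<in> U") (auto simp: f'_def W_def max_def)
      then have "(\<lambda>x. f' x + g x) \<in> inner_functions V"
        using f' g by (auto simp: inner_functions_def intro!: continuous_intros)
      then have "ennreal (\<Lambda> (\<lambda>x. f' x + g x)) \<le> inner_content V"
        by (rule functional_le_inner_content)
      then show ?thesis
        using f' g by (simp add: additive positive flip: ennreal_plus)
    qed
    have "\<Lambda> f \<le> \<Lambda> (\<lambda>x. f' x + e)"
      by (intro functional_mono continuous_intros f f') (auto simp: f'_def)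
    also have "\<dots> = \<Lambda> f' + e"
      using additive[OF f'(1), of "\<lambda>x. e"] by (simp add: functional_const)
    finally have "ennreal (\<Lambda> f) \<le> ennreal (\<Lambda> f') + ennreal e"
      using positive[OF f'] \<open>0 < e\<close> by (simp add: ennreal_leI flip: ennreal_plus)
    then have "ennreal (\<Lambda> f) + outer_content (V - U)
        \<le> (ennreal (\<Lambda> f') + ennreal e) + inner_content W"
      using W by (intro add_mono)
    also have "\<dots> = (ennreal (\<Lambda> f') + inner_content W) + ennreal e"
      by (simp add: ac_simps)
    also have "ennreal (\<Lambda> f') + inner_content W
        = (SUP g\<in>inner_functions W. ennreal (\<Lambda> f') + ennreal (\<Lambda> g))"
      unfolding inner_content_def
      by (rule ennreal_SUP_add_right) (use zero_inner_function in blast)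
    also have "\<dots> \<le> inner_content V"
      by (intro SUP_least sum)
    finally show "ennreal (\<Lambda> f) + outer_content (V - U) \<le> inner_content V + ennreal e"
      by (simp add: add_right_mono)
  qed
  then have "(SUP f\<in>inner_functions (V \<inter> U). ennreal (\<Lambda> f) + outer_content (V - U)) \<le> inner_content V"
    by (rule SUP_least)
  moreover have "(SUP f\<in>inner_functions (V \<inter> U). ennreal (\<Lambda> f) + outer_content (V - U))
      = inner_content (V \<inter> U) + outer_content (V - U)"
    unfolding inner_content_def
    by (rule ennreal_SUP_add_left) (use zero_inner_function in blast)
  ultimately show ?thesis
    by simp
qed

lemma open_in_lambda_system:
  assumes "open U"
  shows "U \<in> lambda_system UNIV (Pow UNIV) outer_content"
proof -
  have "outer_content (U \<inter> A) + outer_content ((UNIV - U) \<inter> A) = outer_content A" for A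
  proof (rule antisym)
    have "outer_content ((U \<inter> A) \<union> ((UNIV - U) \<inter> A))
        \<le> outer_content (U \<inter> A) + outer_content ((UNIV - U) \<inter> A)"
      by (rule outer_content_subadditive)
    moreover have "(U \<inter> A) \<union> ((UNIV - U) \<inter> A) = A"
      by blast
    ultimately show "outer_content A \<le> outer_content (U \<inter> A) + outer_content ((UNIV - U) \<inter> A)"
      by simp
    show "outer_content (U \<inter> A) + outer_content ((UNIV - U) \<inter> A) \<le> outer_content A"
      unfolding outer_content_def[of A]
    proof (rule INF_greatest)
      fix V assume V: "V \<in> {V. open V \<and> A \<subseteq> V}"
      then have "outer_content (U \<inter> A) + outer_content ((UNIV - U) \<inter> A)
          \<le> inner_content (V \<inter> U) + outer_content (V - U)"
        using assms by (intro add_mono outer_content_le outer_content_mono) auto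
      also have "\<dots> \<le> inner_content V"
        using V assms by (intro inner_content_split) auto
      finally show "outer_content (U \<inter> A) + outer_content ((UNIV - U) \<inter> A) \<le> inner_content V" .
    qed
  qed
  then show ?thesis
    by (simp add: lambda_system_def)
qed

definition riesz_measure :: "'a measure"
  where "riesz_measure = measure_of UNIV (sets borel) outer_content"

lemma sets_riesz_measure [measurable_cong, simp]: "sets riesz_measure = sets borel"
  unfolding riesz_measure_def using sets.sigma_sets_eq[of "borel :: 'a measure"] by simp

lemma space_riesz_measure [simp]: "space riesz_measure = UNIV"
  using sets_eq_imp_space_eq[OF sets_riesz_measure] by simp

text \<open>
  Caratheodory's theorem applies, since open sets split every set additively and therefore all
  Borel sets do.
\<close>

lemma emeasure_riesz_measure:
  assumes "A \<in> sets borel"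
  shows "emeasure riesz_measure A = outer_content A"
proof -
  interpret P: sigma_algebra UNIV "Pow (UNIV :: 'a set)"
    by (rule sigma_algebra_Pow)
  let ?S = "lambda_system UNIV (Pow UNIV) outer_content"
  have S: "measure_space UNIV ?S outer_content"
    using outer_measure_space_outer_content by (rule P.caratheodory_lemma)
  then interpret S: sigma_algebra UNIV ?S
    by (simp add: measure_space_def)
  have "sigma_sets UNIV {U. open U} \<subseteq> ?S"
    by (rule S.sigma_sets_subset) (use open_in_lambda_system in blast)
  then have sub: "sets borel \<subseteq> ?S"
    by (simp add: borel_def)
  show ?thesis
    unfolding riesz_measure_def
  proof (rule emeasure_measure_of_sigma)
    show "sigma_algebra UNIV (sets (borel :: 'a measure))"
      using sets.sigma_algebra_axioms[of borel] by simp
    show "positive (sets borel) outer_content"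
      by (simp add: positive_def outer_content_open inner_content_empty)
    show "countably_additive (sets borel) outer_content"
      using S sub by (auto simp: measure_space_def countably_additive_def)
    show "A \<in> sets borel" by fact
  qed
qed

lemma prob_space_riesz_measure: "prob_space riesz_measure"
  by (rule prob_spaceI)
    (simp add: emeasure_riesz_measure outer_content_open inner_content_UNIV)

lemma functional_le_measure:
  assumes "open U" "f \<in> inner_functions U"
  shows "\<Lambda> f \<le> measure riesz_measure U"
proof -
  interpret prob_space riesz_measure
    by (rule prob_space_riesz_measure)
  have "ennreal (\<Lambda> f) \<le> emeasure riesz_measure U"
    using functional_le_inner_content[OF assms(2)] assms(1)
    by (simp add: emeasure_riesz_measure outer_content_open)
  then show ?thesis
    by (simp add: emeasure_eq_measure)
qed

lemma integrable_riesz_measure: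
  fixes f :: "'a \<Rightarrow> real"
  assumes "continuous_on UNIV f"
  shows "integrable riesz_measure f"
proof -
  interpret prob_space riesz_measure
    by (rule prob_space_riesz_measure)
  have "bounded (range f)"
    using compact_continuous_image[OF assms compact_space] by (rule compact_imp_bounded)
  then obtain B where B: "\<And>x. norm (f x) \<le> B"
    by (auto simp: bounded_iff)
  have "f \<in> borel_measurable riesz_measure"
    using borel_measurable_continuous_onI[OF assms]
    by (simp cong: measurable_cong_sets)
  then show ?thesis
    using B by (intro integrable_const_bound[of _ B]) auto
qed

text \<open>
  The layer-cake argument.  Cut \<open>n * f\<close> into \<open>n\<close> layers \<open>g k\<close> of height one.  Each layer lies below
  the indicator of the open set \<open>U k\<close> where \<open>n * f > k\<close>, so the functional of the layer is at most
  the measure of \<open>U k\<close>; and the indicators of the \<open>U k\<close> add up to at most \<open>n * f + 1\<close>.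
\<close>

lemma functional_le_integral:
  assumes f: "continuous_on UNIV f" "\<And>x. 0 \<le> f x" "\<And>x. f x \<le> 1"
  shows "\<Lambda> f \<le> (\<integral>x. f x \<partial>riesz_measure)"
proof (rule field_le_epsilon)
  interpret prob_space riesz_measure
    by (rule prob_space_riesz_measure)
  fix e :: real
  assume "0 < e"
  obtain n :: nat where n: "n > 0" "1 / real n < e"
    using real_arch_inverse[of e] \<open>0 < e\<close> by (auto simp: inverse_eq_divide)
  define U where "U = (\<lambda>k. {x. real k < real n * f x})"
  define g where "g = (\<lambda>k x. min (max (real n * f x - real k) 0) 1)"
  have U: "open (U k)" for k
    unfolding U_def by (intro open_Collect_less continuous_intros f)
  have g: "continuous_on UNIV (g k)" for k
    unfolding g_def by (intro continuous_intros f)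
  have "g k \<in> inner_functions (U k)" for k
    using g by (auto simp: inner_functions_def g_def U_def indicator_def)
  then have le: "\<Lambda> (g k) \<le> measure riesz_measure (U k)" for k
    by (intro functional_le_measure U)
  have "real n * f x = (\<Sum>k<n. g k x)" for x
    unfolding g_def using f(2,3)[of x] n by (subst sum_clamp_eq) (auto simp: min_def mult_left_le)
  then have "real n * \<Lambda> f = \<Lambda> (\<lambda>x. \<Sum>k<n. g k x)"
    using homogeneous[OF f(1), of "real n"] by simp
  also have "\<dots> = (\<Sum>k<n. \<Lambda> (g k))"
    by (intro functional_sum g) simp
  also have "\<dots> \<le> (\<Sum>k<n. measure riesz_measure (U k))"
    by (intro sum_mono le)
  also have "\<dots> = (\<Sum>k<n. \<integral>x. indicator (U k) x \<partial>riesz_measure)"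
    using U by simp
  also have "\<dots> = (\<integral>x. (\<Sum>k<n. indicator (U k) x) \<partial>riesz_measure)"
    using U by (subst Bochner_Integration.integral_sum) (auto simp: emeasure_eq_measure)
  also have "\<dots> \<le> (\<integral>x. real n * f x + 1 \<partial>riesz_measure)"
  proof (rule integral_mono)
    show "integrable riesz_measure (\<lambda>x. real n * f x + 1)"
      by (intro integrable_riesz_measure continuous_intros f)
    show "integrable riesz_measure (\<lambda>x. \<Sum>k<n. indicator (U k) x :: real)"
      using U by (intro Bochner_Integration.integrable_sum) (auto simp: emeasure_eq_measure)
    show "(\<Sum>k<n. indicator (U k) x) \<le> real n * f x + 1" for x
    proof -
      have "(\<Sum>k<n. indicator (U k) x) = (\<Sum>k<n. if real k < real n * f x then 1 else (0::real))"
        by (intro sum.cong) (auto simp: U_def)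
      also have "\<dots> \<le> min (real n) (real n * f x + 1)"
        using f(2)[of x] by (intro sum_indicator_less_le) simp
      finally show ?thesis
        by simp
    qed
  qed
  also have "\<dots> = real n * (\<integral>x. f x \<partial>riesz_measure) + 1"
    using integrable_riesz_measure[OF f(1)] by (simp add: prob_space[unfolded space_riesz_measure])
  finally have "\<Lambda> f \<le> (\<integral>x. f x \<partial>riesz_measure) + 1 / real n"
    using n by (simp add: field_simps)
  then show "\<Lambda> f \<le> (\<integral>x. f x \<partial>riesz_measure) + e"
    using n by simp
qed

text \<open>
  The inequality for functions with values in the unit interval applies to \<open>h\<close> and to \<open>1 - h\<close>, which
  forces equality.  The general case follows by an affine rescaling.
\<close>

theorem functional_eq_integral:
  assumes f: "continuous_on UNIV f"
  shows "\<Lambda> f = (\<integral>x. f x \<partial>riesz_measure)"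
proof -
  interpret prob_space riesz_measure
    by (rule prob_space_riesz_measure)
  have unit: "\<Lambda> h = (\<integral>x. h x \<partial>riesz_measure)"
    if h: "continuous_on UNIV h" "\<And>x. 0 \<le> h x" "\<And>x. h x \<le> 1" for h
  proof (rule antisym)
    show "\<Lambda> h \<le> (\<integral>x. h x \<partial>riesz_measure)"
      by (intro functional_le_integral h)
    have "\<Lambda> (\<lambda>x. 1 + (- 1) * h x) \<le> (\<integral>x. 1 + (- 1) * h x \<partial>riesz_measure)"
      using h by (intro functional_le_integral continuous_intros) auto
    moreover have "\<Lambda> (\<lambda>x. 1 + (- 1) * h x) = 1 - \<Lambda> h"
      using additive[of "\<lambda>x. 1" "\<lambda>x. (- 1) * h x"] homogeneous[of h "- 1"] h
      by (simp add: normalized continuous_on_minus)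
    moreover have "(\<integral>x. 1 + (- 1) * h x \<partial>riesz_measure) = 1 - (\<integral>x. h x \<partial>riesz_measure)"
      using integrable_riesz_measure[OF h(1)] by (simp add: prob_space[unfolded space_riesz_measure])
    ultimately show "(\<integral>x. h x \<partial>riesz_measure) \<le> \<Lambda> h"
      by simp
  qed
  have "bounded (range f)"
    using compact_continuous_image[OF f compact_space] by (rule compact_imp_bounded)
  then obtain B where B: "B > 0" "\<And>x. \<bar>f x\<bar> \<le> B"
    by (auto simp: bounded_pos)
  define h where "h = (\<lambda>x. (f x + B) / (2 * B))"
  have h: "continuous_on UNIV h" "0 \<le> h x" "h x \<le> 1" for x
    using B(1) abs_le_D1[OF B(2)[of x]] abs_le_D2[OF B(2)[of x]]
    by (auto simp: h_def divide_simps intro!: continuous_intros f)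
  have f_eq: "f = (\<lambda>x. - B + (2 * B) * h x)"
    using B(1) by (auto simp: h_def)
  have "\<Lambda> f = - B + (2 * B) * \<Lambda> h"
    unfolding f_eq by (subst additive) (auto intro!: continuous_intros h simp: homogeneous h functional_const)
  also have "\<dots> = - B + (2 * B) * (\<integral>x. h x \<partial>riesz_measure)"
    using unit h by simp
  also have "\<dots> = (\<integral>x. f x \<partial>riesz_measure)"
    using integrable_riesz_measure[OF h(1)] unfolding f_eq by (simp add: prob_space[unfolded space_riesz_measure])
  finally show ?thesis .
qed

end

section \<open>Complex functionals and uniqueness of the representing measure\<close>

lemma integrable_bcontfun:
  fixes f :: "'a::metric_space \<Rightarrow>\<^sub>C complex"
  assumes "\<nu> \<in> borel_prob_measures"
  shows "integrable \<nu> (apply_bcontfun f)"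
proof -
  interpret prob_space \<nu>
    using assms by (simp add: borel_prob_measures_def)
  have "apply_bcontfun f \<in> borel_measurable borel"
    by (intro borel_measurable_continuous_onI) simp
  then have "apply_bcontfun f \<in> borel_measurable \<nu>"
    using assms by (simp add: borel_prob_measures_def cong: measurable_cong_sets)
  then show ?thesis
    by (intro integrable_const_bound[of _ "norm f"]) (auto simp: norm_bounded)
qed

definition complexify :: "('a::topological_space \<Rightarrow> real) \<Rightarrow> ('a \<Rightarrow>\<^sub>C complex)"
  where "complexify g = Bcontfun (\<lambda>x. complex_of_real (g x))"

lemma apply_complexify:
  fixes g :: "'a::topological_space \<Rightarrow> real"
  assumes "compact (UNIV :: 'a set)" "continuous_on UNIV g"
  shows "apply_bcontfun (complexify g) x = complex_of_real (g x)"
proof -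
  have cont: "continuous_on UNIV (\<lambda>x. complex_of_real (g x))"
    by (intro continuous_intros assms)
  then have "bounded (range (\<lambda>x. complex_of_real (g x)))"
    using compact_continuous_image[OF cont assms(1)] by (intro compact_imp_bounded)
  with cont show ?thesis
    by (simp add: complexify_def Bcontfun_inverse bcontfun_def)
qed

lemma measure_open_limit:
  assumes \<nu>: "\<nu> \<in> borel_prob_measures" and U: "open U"
    and g: "continuous_increasing_to_indicator g U"
  shows "(\<lambda>k. \<integral>x. g k x \<partial>\<nu>) \<longlonglongrightarrow> measure \<nu> U"
proof -
  interpret prob_space \<nu>
    using \<nu> by (simp add: borel_prob_measures_def)
  have sets: "sets \<nu> = sets borel"
    using \<nu> by (simp add: borel_prob_measures_def)
  note g = continuous_increasing_to_indicatorD[OF g]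
  have meas: "g k \<in> borel_measurable \<nu>" for k
    using borel_measurable_continuous_onI[OF g(1)[of k]] by (simp add: sets cong: measurable_cong_sets)
  have "(\<lambda>k. \<integral>x. g k x \<partial>\<nu>) \<longlonglongrightarrow> (\<integral>x. indicator U x \<partial>\<nu>)"
  proof (rule integral_dominated_convergence[where w = "\<lambda>x. 1"])
    have "norm (g k x) \<le> 1" for k x
      using g(2)[of k x] g(3)[of k x] by (auto intro: order_trans[OF _ indicator_le_1])
    then show "AE x in \<nu>. norm (g k x) \<le> 1" for k
      by simp
    have "U \<in> sets \<nu>"
      using U sets by simp
    then show "(indicator U :: 'a \<Rightarrow> real) \<in> borel_measurable \<nu>"
      by simp
  qed (use g meas in auto)
  then show ?thesis
    using U sets by simp
qed

text \<open>
  Integrals of continuous functions determine the measure of every open set, by monotone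
  approximation of its indicator, and the open sets form a generator stable under intersection.
\<close>

lemma borel_prob_measures_eqI:
  fixes \<mu> \<nu> :: "'a::metric_space measure"
  assumes compact: "compact (UNIV :: 'a set)"
    and \<mu>: "\<mu> \<in> borel_prob_measures" and \<nu>: "\<nu> \<in> borel_prob_measures"
    and eq: "\<And>f. (\<integral>x. apply_bcontfun f x \<partial>\<mu>) = (\<integral>x. apply_bcontfun f x \<partial>\<nu> :: complex)"
  shows "\<mu> = \<nu>"
proof (rule measure_eqI_generator_eq[where E = "{U. open U}" and \<Omega> = UNIV and A = "\<lambda>_. UNIV"])
  interpret \<mu>: prob_space \<mu>
    using \<mu> by (simp add: borel_prob_measures_def)
  interpret \<nu>: prob_space \<nu>
    using \<nu> by (simp add: borel_prob_measures_def)
  show "sets \<mu> = sigma_sets UNIV {U. open U}" "sets \<nu> = sigma_sets UNIV {U. open U}"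
    using \<mu> \<nu> by (auto simp: borel_prob_measures_def borel_def)
  show "emeasure \<mu> U = emeasure \<nu> U" if U: "U \<in> {U. open U}" for U
  proof -
    obtain g where g: "continuous_increasing_to_indicator g U"
      using open_indicator_approximation[of U] U by blast
    have "(\<integral>x. g k x \<partial>\<mu>) = (\<integral>x. g k x \<partial>\<nu>)" for k
      using eq[of "complexify (g k)"] continuous_increasing_to_indicatorD(1)[OF g]
      by (simp add: apply_complexify[OF compact])
    then have "(\<lambda>k. \<integral>x. g k x \<partial>\<mu>) \<longlonglongrightarrow> measure \<nu> U"
      using measure_open_limit[OF \<nu> _ g] that by simp
    then have "measure \<mu> U = measure \<nu> U"
      using measure_open_limit[OF \<mu> _ g] that by (intro LIMSEQ_unique) auto
    then show ?thesis
      by (simp add: \<mu>.emeasure_eq_measure \<nu>.emeasure_eq_measure)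
  qed
qed (use \<mu> in \<open>auto simp: Int_stable_def borel_prob_measures_def prob_space_def
    finite_measure.emeasure_finite\<close>)

text \<open>
  A positive functional takes real values on real functions: adding a large constant makes the
  function nonnegative.  Its real part on real functions is therefore represented by a measure, and
  complex linearity extends the representation to complex functions.
\<close>

theorem riesz_representation:
  fixes \<Lambda> :: "('a::metric_space \<Rightarrow>\<^sub>C complex) \<Rightarrow> complex"
  assumes compact: "compact (UNIV :: 'a set)"
    and additive: "\<And>f g. \<Lambda> (f + g) = \<Lambda> f + \<Lambda> g"
    and homogeneous: "\<And>c f. \<Lambda> (scaleC_bcontfun c f) = c * \<Lambda> f"
    and nonneg: "\<And>f. (\<And>x. apply_bcontfun f x \<in> \<real>\<^sub>\<ge>\<^sub>0) \<Longrightarrow> \<Lambda> f \<in> \<real>\<^sub>\<ge>\<^sub>0"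
    and normalized: "\<Lambda> (const_bcontfun 1) = 1"
  shows "\<exists>!\<nu>. \<nu> \<in> borel_prob_measures \<and> (\<forall>f. \<Lambda> f = (\<integral>x. apply_bcontfun f x \<partial>\<nu>))"
proof -
  note complexify_eq = apply_complexify[OF compact]
  have add: "complexify (\<lambda>x. f x + g x) = complexify f + complexify g"
    if "continuous_on UNIV f" "continuous_on UNIV g" for f g :: "'a \<Rightarrow> real"
    by (intro bcontfun_eqI) (simp add: complexify_eq that continuous_on_add plus_bcontfun.rep_eq)
  have scale: "complexify (\<lambda>x. c * f x) = scaleC_bcontfun (complex_of_real c) (complexify f)"
    if "continuous_on UNIV f" for c and f :: "'a \<Rightarrow> real"
    by (intro bcontfun_eqI) (simp add: complexify_eq that continuous_on_mult_left apply_scaleC_bcontfun)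
  have one: "complexify (\<lambda>x::'a. 1) = const_bcontfun 1"
    by (intro bcontfun_eqI) (simp add: complexify_eq const_bcontfun.rep_eq)
  have nonneg_real: "\<Lambda> (complexify f) \<in> \<real>\<^sub>\<ge>\<^sub>0" if "continuous_on UNIV f" "\<And>x. 0 \<le> f x" for f
    using that by (intro nonneg) (simp add: complexify_eq nonneg_Reals_of_real_iff)
  have real: "\<Lambda> (complexify f) \<in> \<real>" if f: "continuous_on UNIV f" for f :: "'a \<Rightarrow> real"
  proof -
    have "bounded (range f)"
      using compact_continuous_image[OF f compact] by (rule compact_imp_bounded)
    then obtain B where B: "\<And>x. \<bar>f x\<bar> \<le> B"
      by (auto simp: bounded_iff)
    have "0 \<le> f x + B * 1" for x
      using B[of x] by linarith
    then have "\<Lambda> (complexify (\<lambda>x. f x + B * 1)) \<in> \<real>\<^sub>\<ge>\<^sub>0"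
      by (intro nonneg_real continuous_intros f)
    moreover have "\<Lambda> (complexify (\<lambda>x. f x + B * 1)) = \<Lambda> (complexify f) + complex_of_real B"
      using f scale[of "\<lambda>x. 1" B]
      by (simp del: mult_1_right add: add one additive homogeneous normalized)
    ultimately have "\<Lambda> (complexify f) + complex_of_real B \<in> \<real>"
      using nonneg_Reals_subset_Reals by auto
    then show ?thesis
      by (metis Reals_diff Reals_of_real add_diff_cancel_right')
  qed
  interpret riesz: positive_normalized_functional "\<lambda>f. Re (\<Lambda> (complexify f))"
  proof
    show "0 \<le> Re (\<Lambda> (complexify f))" if "continuous_on UNIV f" "\<And>x. 0 \<le> f x" for f
      using nonneg_real[OF that] by (simp add: complex_nonneg_Reals_iff)
  qed (simp_all add: compact add scale one additive homogeneous normalized)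
  have riesz_in: "riesz.riesz_measure \<in> borel_prob_measures"
    by (simp add: borel_prob_measures_def riesz.prob_space_riesz_measure)
  have repr: "\<Lambda> f = (\<integral>x. apply_bcontfun f x \<partial>riesz.riesz_measure)"
        for f :: "'a \<Rightarrow>\<^sub>C complex"
  proof -
    have cont: "continuous_on UNIV (\<lambda>x. Re (apply_bcontfun f x))"
      "continuous_on UNIV (\<lambda>x. Im (apply_bcontfun f x))"
      by (intro continuous_intros; simp)+
    have f_eq: "f = complexify (\<lambda>x. Re (apply_bcontfun f x))
        + scaleC_bcontfun \<i> (complexify (\<lambda>x. Im (apply_bcontfun f x)))"
      by (intro bcontfun_eqI)
        (simp add: complexify_eq cont plus_bcontfun.rep_eq apply_scaleC_bcontfun complex_eq[symmetric])
    have "\<Lambda> f = \<Lambda> (complexify (\<lambda>x. Re (apply_bcontfun f x)))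
        + \<i> * \<Lambda> (complexify (\<lambda>x. Im (apply_bcontfun f x)))"
      using arg_cong[OF f_eq, of \<Lambda>] by (simp only: additive homogeneous)
    also have "\<dots> = complex_of_real (\<integral>x. Re (apply_bcontfun f x) \<partial>riesz.riesz_measure)
        + \<i> * complex_of_real (\<integral>x. Im (apply_bcontfun f x) \<partial>riesz.riesz_measure)"
      by (simp only: of_real_Re[OF real[OF cont(1)]] of_real_Re[OF real[OF cont(2)]]
          riesz.functional_eq_integral[OF cont(1), symmetric]
          riesz.functional_eq_integral[OF cont(2), symmetric])
    also have "\<dots> = (\<integral>x. apply_bcontfun f x \<partial>riesz.riesz_measure)"
      using integrable_bcontfun[OF riesz_in, of f]
      by (simp add: complex_eq_iff)
    finally show ?thesis .
  qed
  show ?thesis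
  proof (rule ex1I[of _ riesz.riesz_measure])
    show "riesz.riesz_measure \<in> borel_prob_measures \<and>
        (\<forall>f. \<Lambda> f = (\<integral>x. apply_bcontfun f x \<partial>riesz.riesz_measure))"
      using riesz_in repr by blast
    show "\<nu> = riesz.riesz_measure"
      if "\<nu> \<in> borel_prob_measures \<and> (\<forall>f. \<Lambda> f = (\<integral>x. apply_bcontfun f x \<partial>\<nu>))" for \<nu>
    proof (rule borel_prob_measures_eqI[OF compact])
      show "(\<integral>x. apply_bcontfun f x \<partial>\<nu>) = (\<integral>x. apply_bcontfun f x \<partial>riesz.riesz_measure)"
        for f :: "'a \<Rightarrow>\<^sub>C complex"
        using that repr[of f] by metis
    qed (use that riesz_in in blast)+
  qed
qed

section \<open>Transfer operators as Markov kernels\<close>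

locale compact_transfer =
  fixes L :: "('a::metric_space \<Rightarrow>\<^sub>C complex) \<Rightarrow> ('a \<Rightarrow>\<^sub>C complex)"
  assumes compact: "compact (UNIV :: 'a set)"
    and transfer: "transfer_operator L"
begin

lemma module_hom_transfer: "module_hom scaleC_bcontfun scaleC_bcontfun L"
  using transfer by (simp add: transfer_operator_def module_hom_iff_linear)

lemma transfer_add: "L (f + g) = L f + L g"
  by (rule module_hom.add[OF module_hom_transfer])

lemma transfer_scale: "L (scaleC_bcontfun c f) = scaleC_bcontfun c (L f)"
  by (rule module_hom.scale[OF module_hom_transfer])

lemma transfer_nonneg:
  "(\<And>x. apply_bcontfun f x \<in> \<real>\<^sub>\<ge>\<^sub>0) \<Longrightarrow> apply_bcontfun (L f) x \<in> \<real>\<^sub>\<ge>\<^sub>0"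
  using transfer by (auto simp: transfer_operator_def)

lemma transfer_one: "L (const_bcontfun 1) = const_bcontfun 1"
  using transfer by (simp add: transfer_operator_def)

text \<open>
  Evaluation of \<open>L f\<close> at a point is a positive normalized functional of \<open>f\<close>.
\<close>

lemma transition_prob:
  shows transition_prob_in: "transition_prob L x \<in> borel_prob_measures"
    and transfer_eq_integral:
      "apply_bcontfun (L f) x = (\<integral>y. apply_bcontfun f y \<partial>transition_prob L x)"
proof -
  have "\<exists>!\<nu>. \<nu> \<in> borel_prob_measures \<and>
      (\<forall>f. apply_bcontfun (L f) x = (\<integral>y. apply_bcontfun f y \<partial>\<nu>))"
    by (rule riesz_representation[OF compact])
      (simp_all add: transfer_add transfer_scale transfer_nonneg transfer_one plus_bcontfun.rep_eq
        apply_scaleC_bcontfun const_bcontfun.rep_eq)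
  from theI'[OF this] show "transition_prob L x \<in> borel_prob_measures"
    "apply_bcontfun (L f) x = (\<integral>y. apply_bcontfun f y \<partial>transition_prob L x)"
    unfolding transition_prob_def by blast+
qed

lemma sets_transition_prob: "sets (transition_prob L x) = sets borel"
  using transition_prob_in by (auto simp: borel_prob_measures_def)

lemma prob_space_transition_prob: "prob_space (transition_prob L x)"
  using transition_prob_in by (auto simp: borel_prob_measures_def)

text \<open>
  The functional \<open>f \<mapsto> \<integral> L f d\<mu>\<close> has a unique representing measure; this is what makes the
  definite description of the dual meaningful.
\<close>

lemma dual_transfer_operator_integral:
  assumes \<mu>: "\<mu> \<in> borel_prob_measures"
  shows "(\<integral>x. apply_bcontfun f x \<partial>dual_transfer_operator L \<mu>) = (\<integral>x. apply_bcontfun (L f) x \<partial>\<mu>)"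
proof -
  interpret prob_space \<mu>
    using \<mu> by (simp add: borel_prob_measures_def)
  have "\<exists>!\<nu>. \<nu> \<in> borel_prob_measures \<and>
      (\<forall>f. (\<integral>x. apply_bcontfun (L f) x \<partial>\<mu>) = (\<integral>x. apply_bcontfun f x \<partial>\<nu>))"
  proof (rule riesz_representation[OF compact])
    fix f :: "'a \<Rightarrow>\<^sub>C complex"
    assume "\<And>x. apply_bcontfun f x \<in> \<real>\<^sub>\<ge>\<^sub>0"
    then have "0 \<le> Re (apply_bcontfun (L f) x)" "Im (apply_bcontfun (L f) x) = 0" for x
      using transfer_nonneg[of f x] by (auto simp: complex_nonneg_Reals_iff)
    then show "(\<integral>x. apply_bcontfun (L f) x \<partial>\<mu>) \<in> \<real>\<^sub>\<ge>\<^sub>0"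
      using integrable_bcontfun[OF \<mu>, of "L f"]
      by (simp add: complex_nonneg_Reals_iff flip: integral_Re integral_Im)
  qed (simp_all add: transfer_add transfer_scale transfer_one plus_bcontfun.rep_eq
      apply_scaleC_bcontfun const_bcontfun.rep_eq integrable_bcontfun[OF \<mu>] prob_space)
  note representing = theI'[OF this]
  have "dual_transfer_operator L \<mu> = (THE \<nu>. \<nu> \<in> borel_prob_measures \<and>
      (\<forall>f. (\<integral>x. apply_bcontfun (L f) x \<partial>\<mu>) = (\<integral>x. apply_bcontfun f x \<partial>\<nu>)))"
    unfolding dual_transfer_operator_def
    by (intro arg_cong[of _ _ The] ext conj_cong refl all_cong1) (rule eq_commute)
  with representing show ?thesis
    by metis
qed

text \<open>
  For open \<open>U\<close>, the probability \<open>P(x, U)\<close> is the limit of \<open>(L g) x\<close> along continuous functions \<open>g\<close>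
  increasing to the indicator of \<open>U\<close>, hence a pointwise limit of continuous functions of \<open>x\<close>.  The
  open sets generate the rest.
\<close>

lemma transition_prob_measurable: "transition_prob L \<in> borel \<rightarrow>\<^sub>M subprob_algebra borel"
proof (rule measurable_subprob_algebra_generated[where \<Omega> = UNIV and G = "{U. open U}"])
  show "sets borel = sigma_sets UNIV {U :: 'a set. open U}"
    by (simp add: borel_def)
  show "subprob_space (transition_prob L x)" for x
    by (intro prob_space_imp_subprob_space prob_space_transition_prob)
  show "sets (transition_prob L x) = sets borel" for x
    by (rule sets_transition_prob)
  have meas: "(\<lambda>x. emeasure (transition_prob L x) U) \<in> borel_measurable borel" if U: "open U" for U
  proof -
    obtain g where g: "continuous_increasing_to_indicator g U"
      using open_indicator_approximation[OF U] by blast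
    have "(\<lambda>x. measure (transition_prob L x) U) \<in> borel_measurable borel"
    proof (rule borel_measurable_LIMSEQ_real)
      show "(\<lambda>k. \<integral>y. g k y \<partial>transition_prob L x) \<longlonglongrightarrow> measure (transition_prob L x) U" for x
        by (rule measure_open_limit[OF transition_prob_in that g])
      fix k
      have "complex_of_real (\<integral>y. g k y \<partial>transition_prob L x)
          = apply_bcontfun (L (complexify (g k))) x" for x
        by (simp add: transfer_eq_integral apply_complexify[OF compact]
            continuous_increasing_to_indicatorD(1)[OF g])
      then have "(\<integral>y. g k y \<partial>transition_prob L x) = Re (apply_bcontfun (L (complexify (g k))) x)" for x
        by (metis Re_complex_of_real)
      then show "(\<lambda>x. \<integral>y. g k y \<partial>transition_prob L x) \<in> borel_measurable borel"
        by (auto intro!: borel_measurable_continuous_onI continuous_intros)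
    qed
    moreover have "emeasure (transition_prob L x) U = ennreal (measure (transition_prob L x) U)" for x
      using prob_space_transition_prob
      by (intro finite_measure.emeasure_eq_measure) (simp add: prob_space_def)
    ultimately show ?thesis
      by simp
  qed
  then show "(\<lambda>x. emeasure (transition_prob L x) U) \<in> borel_measurable borel" if "U \<in> {U. open U}" for U
    using that by simp
  show "(\<lambda>x. emeasure (transition_prob L x) UNIV) \<in> borel_measurable borel"
    by (intro meas) simp
qed (auto simp: Int_stable_def)

text \<open>
  On real Borel functions the choice hidden in the extension is immaterial, and the extension is the
  averaging operator of the kernel.
\<close>

lemma extended_operator_of_real:
  assumes "f \<in> borel_measurable borel"
  shows "extended_operator L (\<lambda>y. complex_of_real (f y)) x
    = complex_of_real (\<integral>y. f y \<partial>transition_prob L x)"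
  unfolding extended_operator_def
  using assms by (subst L_infty_integral_eq[OF transition_prob_in, where g = "\<lambda>y. complex_of_real (f y)"]) auto

text \<open>
  The measure \<open>\<mu> \<bind> P\<close> integrates a continuous function \<open>f\<close> to \<open>\<integral> L f d\<mu>\<close>, and so does the dual
  \<open>L\<^sup>*\<mu> = \<mu>\<close>; measures that agree on continuous functions are equal.
\<close>

lemma invariant_kernel_transition_prob:
  assumes \<mu>: "\<mu> \<in> borel_prob_measures" and inv: "dual_transfer_operator L \<mu> = \<mu>"
  shows "invariant_kernel \<mu> (transition_prob L)"
proof -
  interpret prob_space \<mu>
    using \<mu> by (simp add: borel_prob_measures_def)
  have sets: "sets \<mu> = sets borel"
    using \<mu> by (simp add: borel_prob_measures_def)
  have space: "space \<mu> = UNIV"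
    using sets_eq_imp_space_eq[OF sets] by simp
  have kernel: "transition_prob L \<in> \<mu> \<rightarrow>\<^sub>M subprob_algebra borel"
    using transition_prob_measurable by (simp add: sets cong: measurable_cong_sets)
  have sets_bind: "sets (\<mu> \<bind> transition_prob L) = sets borel"
    by (rule sets_bind) (simp_all add: sets_transition_prob space)
  have integral: "(\<integral>x. g x \<partial>(\<mu> \<bind> transition_prob L)) = (\<integral>x. \<integral>y. g y \<partial>transition_prob L x \<partial>\<mu>)"
    if "g \<in> borel_measurable borel" "\<And>x. \<bar>g x\<bar> \<le> B" for g :: "'a \<Rightarrow> real" and B
  proof (rule integral_bind[where K = borel and B = B and B' = 1])
    show "AE x in \<mu>. emeasure (transition_prob L x) (space (transition_prob L x)) \<le> ennreal 1"
      using prob_space.emeasure_space_1[OF prob_space_transition_prob] by simp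
  qed (use that kernel in \<open>auto intro: finite_measure_axioms\<close>)
  have prob: "prob_space (\<mu> \<bind> transition_prob L)"
    by (rule prob_space_bind[OF _ kernel]) (simp add: prob_space_transition_prob)
  have bind: "\<mu> \<bind> transition_prob L \<in> borel_prob_measures"
    by (simp add: borel_prob_measures_def prob sets_bind)
  have "\<mu> \<bind> transition_prob L = \<mu>"
  proof (rule borel_prob_measures_eqI[OF compact bind \<mu>])
    fix f :: "'a \<Rightarrow>\<^sub>C complex"
    have meas: "apply_bcontfun f \<in> borel_measurable borel"
      by (intro borel_measurable_continuous_onI) simp
    have bound: "\<bar>Re (apply_bcontfun f x)\<bar> \<le> norm f" "\<bar>Im (apply_bcontfun f x)\<bar> \<le> norm f" for x
      using norm_bounded[of f x] abs_Re_le_cmod abs_Im_le_cmod order_trans by blast+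
    have re: "(\<integral>x. Re (apply_bcontfun f x) \<partial>(\<mu> \<bind> transition_prob L))
        = (\<integral>x. Re (apply_bcontfun (L f) x) \<partial>\<mu>)"
      by (subst integral[OF _ bound(1)])
        (use meas in \<open>auto simp: transfer_eq_integral integrable_bcontfun[OF transition_prob_in]\<close>)
    have im: "(\<integral>x. Im (apply_bcontfun f x) \<partial>(\<mu> \<bind> transition_prob L))
        = (\<integral>x. Im (apply_bcontfun (L f) x) \<partial>\<mu>)"
      by (subst integral[OF _ bound(2)])
        (use meas in \<open>auto simp: transfer_eq_integral integrable_bcontfun[OF transition_prob_in]\<close>)
    have "(\<integral>x. apply_bcontfun f x \<partial>(\<mu> \<bind> transition_prob L)) = (\<integral>x. apply_bcontfun (L f) x \<partial>\<mu>)"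
      using re im integrable_bcontfun[OF bind, of f] integrable_bcontfun[OF \<mu>, of "L f"]
      by (simp add: complex_eq_iff)
    also have "\<dots> = (\<integral>x. apply_bcontfun f x \<partial>\<mu>)"
      using dual_transfer_operator_integral[OF \<mu>, of f] by (simp add: inv)
    finally show "(\<integral>x. apply_bcontfun f x \<partial>(\<mu> \<bind> transition_prob L)) = (\<integral>x. apply_bcontfun f x \<partial>\<mu>)" .
  qed
  moreover have "transition_prob L \<in> \<mu> \<rightarrow>\<^sub>M subprob_algebra \<mu>"
    using kernel by (simp add: subprob_algebra_cong[OF sets])
  ultimately show ?thesis
    by (intro invariant_kernel.intro invariant_kernel_axioms.intro prob_space_axioms
        prob_space_transition_prob)
qed

end

section \<open>Birkhoff averages above a level on an invariant set\<close>

text \<open>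
  The iterates of the extended operator on \<open>\<phi>\<close> are those of the averaging operator, and
  \<open>L \<chi>\<^sub>A = \<chi>\<^sub>A\<close> says in particular that \<open>P(x, A) = 1\<close> for almost every \<open>x\<close> in \<open>A\<close>.  A supremum above
  \<open>\<alpha>\<close> has a member above \<open>\<alpha>\<close>.
\<close>

theorem corollary1:
  fixes L :: "('a::metric_space \<Rightarrow>\<^sub>C complex) \<Rightarrow> ('a \<Rightarrow>\<^sub>C complex)"
    and \<mu> :: "'a measure" and \<phi> :: "'a \<Rightarrow> real" and \<alpha> :: real and A :: "'a set"
  assumes "compact (UNIV :: 'a set)"
    and "transfer_operator L"
    and "\<mu> \<in> borel_prob_measures"
    and "dual_transfer_operator L \<mu> = \<mu>"
    and "\<phi> \<in> borel_measurable borel"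
    and "bounded (range \<phi>)"
    and "A \<in> sets borel"
    and "A \<subseteq> superlevel_set L \<phi> \<alpha>"
    and "AE x in \<mu>. extended_operator L (indicator A) x = indicator A x"
  shows "(\<integral>x\<in>A. \<phi> x \<partial>\<mu>) \<ge> \<alpha> * measure \<mu> A"
proof -
  interpret compact_transfer L
    by standard fact+
  interpret invariant_kernel \<mu> "transition_prob L"
    using assms by (intro invariant_kernel_transition_prob)
  have sets: "sets \<mu> = sets borel"
    using assms by (simp add: borel_prob_measures_def)
  have borel: "borel_measurable \<mu> = (borel_measurable borel :: ('a \<Rightarrow> real) set)"
    by (intro measurable_cong_sets sets refl)
  have \<phi>: "bounded_measurable \<phi>"
    using assms(5,6) by (auto simp: bounded_measurable_def borel bounded_iff)
  have iterate: "(extended_operator L ^^ j) (\<lambda>y. complex_of_real (\<phi> y))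
      = (\<lambda>x. complex_of_real ((average ^^ j) \<phi> x))" for j
  proof (induction j)
    case 0
    then show ?case by simp
  next
    case (Suc j)
    have meas: "(average ^^ j) \<phi> \<in> borel_measurable borel"
      using bounded_measurable_imp_measurable[OF bounded_measurable_funpow_average[OF \<phi>]]
      by (simp add: borel)
    have "extended_operator L (\<lambda>y. complex_of_real ((average ^^ j) \<phi> y))
        = (\<lambda>x. complex_of_real (average ((average ^^ j) \<phi>) x))"
      unfolding average_def[of "(average ^^ j) \<phi>"]
      by (rule ext) (rule extended_operator_of_real[OF meas])
    with Suc show ?case
      by simp
  qed
  show ?thesis
  proof (rule maximal_inequality_level[OF \<phi>])
    show "A \<in> sets \<mu>"
      using assms by (simp add: sets)
    have indicator: "extended_operator L (indicator A) x
        = complex_of_real (measure (transition_prob L x) A)" for x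
      using extended_operator_of_real[of "indicator A" x] assms(7) sets_transition_prob[of x]
      by (simp add: of_real_indicator)
    show "AE x in \<mu>. x \<in> A \<longrightarrow> measure (transition_prob L x) A = 1"
      using assms(9) by eventually_elim (auto simp: indicator)
    fix x assume "x \<in> A"
    then have sup: "\<alpha> < (SUP n\<in>{1..}. (\<Sum>j<n. (average ^^ j) \<phi> x) / real n)"
      using assms(8) by (auto simp: superlevel_set_def birkhoff_sum_def iterate)
    show "\<exists>n\<ge>1. \<alpha> < (\<Sum>j<n. (average ^^ j) \<phi> x) / real n"
    proof (rule ccontr)
      assume "\<not> ?thesis"
      then have "(SUP n\<in>{1..}. (\<Sum>j<n. (average ^^ j) \<phi> x) / real n) \<le> \<alpha>"
        by (intro cSUP_least) (auto simp: not_less)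
      with sup show False
        by simp
    qed
  qed
qed

end
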